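(* Let $\mu$ be a measure of compact support on $\mathbb{R}$ and let $E\subset\operatorname{supp}(\mu)$ be a compact set that is essentially perfect and has $C(E)>0$. Suppose the equilibrium measure $\rho_E$ is absolutely continuous with respect to $\mu$, and that for some subsequence $n(1)<n(2)<\cdots$ the monic orthogonal polynomials $P_n(x;d\mu)$ satisfy $\|P_{n(j)}\|_{L^2(\mathbb{R},d\mu)}^{1/n(j)}\to C(E)$. Then the zero counting measures $\nu_{n(j)}$ of $P_{n(j)}$ converge weakly to $\rho_E$.
   Context: Capacity: $C(K)=\exp(-\inf\{\iint\log|x-y|^{-1}d\nu d\nu:\nu\text{ probability measure on }K\})$ for compact $K$; for $C(K)>0$ the equilibrium measure $\rho_K$ is the unique probability measure on $K$ attaining the infimum. A compact $E\subset\mathbb{R}$ is essentially perfect if $|E\cap(x-\delta,x+\delta)|>0$ (Lebesgue measure) for every $x\in E$ and $\delta>0$. The zero counting measure of $P_n$ is $\frac1n\sum\delta_{z_j}$ over zeros with multiplicity. *)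

theory Defs
  imports "HOL-Probability.Probability" "HOL-Computational_Algebra.Polynomial"
begin

definition msupp :: "real measure \<Rightarrow> real set" where
  "msupp M = {x. \<forall>e>0. emeasure M (ball x e) > 0}"

definition prob_measures_on :: "real set \<Rightarrow> real measure set" where
  "prob_measures_on K = {\<nu>. prob_space \<nu> \<and> sets \<nu> = sets borel \<and> emeasure \<nu> K = 1}"

text \<open>Logarithmic energy  \<integral>\<integral> log (1/|x-y|) d\<nu>(x) d\<nu>(y)  (value +\<infinity> on the diagonal),
  split into positive and negative parts.\<close>
definition log_energy :: "real measure \<Rightarrow> ereal" where
  "log_energy \<nu> =
     enn2ereal (\<integral>\<^sup>+x. \<integral>\<^sup>+y. (if x = y then \<infinity> else ennreal (max 0 (- ln \<bar>x - y\<bar>))) \<partial>\<nu> \<partial>\<nu>)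
   - enn2ereal (\<integral>\<^sup>+x. \<integral>\<^sup>+y. ennreal (max 0 (ln \<bar>x - y\<bar>)) \<partial>\<nu> \<partial>\<nu>)"

definition capacity :: "real set \<Rightarrow> real" where
  "capacity K = (let I = Inf (log_energy ` prob_measures_on K) in
                  if I = \<infinity> then 0 else exp (- real_of_ereal I))"

definition is_equilibrium_measure :: "real set \<Rightarrow> real measure \<Rightarrow> bool" where
  "is_equilibrium_measure K \<rho> \<longleftrightarrow>
     \<rho> \<in> prob_measures_on K \<and> log_energy \<rho> = Inf (log_energy ` prob_measures_on K)"

definition essentially_perfect :: "real set \<Rightarrow> bool" where
  "essentially_perfect E \<longleftrightarrow>
     (\<forall>x\<in>E. \<forall>\<delta>>0. emeasure lborel (E \<inter> {x - \<delta> <..< x + \<delta>}) > 0)"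

definition is_monic_OP :: "real measure \<Rightarrow> nat \<Rightarrow> real poly \<Rightarrow> bool" where
  "is_monic_OP \<mu> n P \<longleftrightarrow> degree P = n \<and> lead_coeff P = 1 \<and>
     (\<forall>q. degree q < n \<longrightarrow> (\<integral>x. poly P x * poly q x \<partial>\<mu>) = 0)"

definition L2_norm_poly :: "real measure \<Rightarrow> real poly \<Rightarrow> real" where
  "L2_norm_poly \<mu> P = sqrt (\<integral>x. (poly P x)\<^sup>2 \<partial>\<mu>)"

definition zero_counting_measure :: "real poly \<Rightarrow> complex measure" where
  "zero_counting_measure P =
     (let p = map_poly complex_of_real P in
      measure_of UNIV (sets borel)
        (\<lambda>A. (\<Sum>z\<in>{z. poly p z = 0}. of_nat (order z p) * indicator A z) / of_nat (degree p)))"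

definition weakly_converges :: "(nat \<Rightarrow> 'a::metric_space measure) \<Rightarrow> 'a measure \<Rightarrow> bool" where
  "weakly_converges Ms M \<longleftrightarrow>
     (\<forall>f :: 'a \<Rightarrow> real. continuous_on UNIV f \<and> bounded (range f) \<longrightarrow>
        (\<lambda>n. \<integral>x. f x \<partial>(Ms n)) \<longlonglongrightarrow> (\<integral>x. f x \<partial>M))"

end

theory Submission
  imports Defs "HOL-Computational_Algebra.Fundamental_Theorem_Algebra"
begin

text \<open>
  Put \<open>R\<close> large, replace \<open>log (1/|x - y|)\<close> by the nonnegative kernel \<open>log\<^sup>+ (R/|x - y|)\<close>, which differs from it
  by the constant \<open>log R\<close> on the support of \<open>\<mu>\<close>, and let \<open>V\<close> be the energy of \<open>\<rho>\<close>, so that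
  \<open>C(E) = R exp (- V)\<close>. By Chebyshev's inequality and Borel--Cantelli the norm asymptotics give
  \<open>liminf U\<^bsub>\<nu>(j)\<^esub> \<ge> V\<close> \<open>\<mu>\<close>-almost everywhere, hence \<open>\<rho>\<close>-almost everywhere, where \<open>\<nu>(j)\<close> is the zero
  counting measure and \<open>U\<close> the potential. For a weak limit \<open>\<nu>\<close> of \<open>\<nu>(j)\<close> it follows that \<open>U\<^bsub>\<nu>\<^esub> \<ge> V\<close>
  \<open>\<rho>\<close>-almost everywhere. Since \<open>U\<^bsub>\<rho>\<^esub> \<le> V\<close> (Frostman), \<open>V \<le> \<integral> U\<^bsub>\<nu>\<^esub> d\<rho> = \<integral> U\<^bsub>\<rho>\<^esub> d\<nu> \<le> V\<close>, so \<open>U\<^bsub>\<nu>\<^esub> = V\<close>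
  \<open>\<rho>\<close>-almost everywhere and \<open>U\<^bsub>\<rho>\<^esub> = V\<close> \<open>\<nu>\<close>-almost everywhere. The set
  \<open>S = {x \<in> E. U\<^bsub>\<rho>\<^esub> \<le> V, U\<^bsub>\<nu>\<^esub> \<le> V}\<close> is closed by lower semicontinuity and has full \<open>\<rho>\<close>-measure, so the
  maximum principle gives \<open>U\<^bsub>\<rho>\<^esub> < V\<close> off \<open>S\<close>. Therefore \<open>\<nu>\<close> lives on \<open>S\<close>, its energy is at most \<open>V\<close>, and
  strict positive definiteness of the kernel yields \<open>\<nu> = \<rho>\<close>.\<close>

section \<open>Logarithmic kernel and potentials\<close>

text \<open>\<open>ennreal\<close> sends negative reals to 0, so this is the positive part of the
  logarithm. The diagonal is prescribed by hand because \<open>ln\<close> takes only finite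
  values.\<close>

definition log_kernel :: "real \<Rightarrow> real \<Rightarrow> real \<Rightarrow> ennreal" where
  "log_kernel R x y = (if x = y then \<infinity> else ennreal (ln (R / \<bar>x - y\<bar>)))"

definition potential :: "real \<Rightarrow> real measure \<Rightarrow> real \<Rightarrow> ennreal" where
  "potential R \<nu> x = (\<integral>\<^sup>+y. log_kernel R x y \<partial>\<nu>)"

lemma log_kernel_commute: "log_kernel R x y = log_kernel R y x"
  by (simp add: log_kernel_def abs_minus_commute)

text \<open>Truncating the kernel at height \<open>m\<close> amounts to clamping the distance
  between \<open>R * exp (- m)\<close> and \<open>R\<close>. The lower clamp removes the singularity
  and the upper one accounts for the positive part, so the argument of \<open>ln\<close> is
  continuous and positive.\<close>

lemma min_log_kernel:
  assumes "R > 0"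
  shows "min (log_kernel R x y) (of_nat m) =
    ennreal (ln (R / max (R * exp (- real m)) (min R \<bar>x - y\<bar>)))"
proof (cases "x = y")
  case True
  have "ln (R / (R * exp (- real m))) = real m" "R * exp (- real m) > 0"
    using assms by (simp_all add: ln_div ln_mult)
  moreover have "max (R * exp (- real m)) 0 = R * exp (- real m)"
    using assms by simp
  ultimately show ?thesis using assms True
    by (simp only: log_kernel_def) (simp add: ennreal_of_nat_eq_real_of_nat)
next
  case False
  define d where "d = \<bar>x - y\<bar>"
  have d: "d > 0" using False by (simp add: d_def)
  have "min (log_kernel R x y) (of_nat m) = ennreal (min (max 0 (ln (R / d))) (real m))"
    using False by (simp add: log_kernel_def d_def ennreal_of_nat_eq_real_of_nat min_def max_def ennreal_neg)
  also have "min (max 0 (ln (R / d))) (real m) = ln (R / max (R * exp (- real m)) (min R d))"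
  proof (cases "d \<le> R * exp (- real m)")
    case True
    then have "exp (real m) \<le> R / d" using d by (simp add: exp_minus field_simps)
    then have "real m \<le> ln (R / d)" using d assms by (simp add: ln_ge_iff)
    moreover have "max (R * exp (- real m)) (min R d) = R * exp (- real m)"
      using True by auto
    moreover have "ln (R / (R * exp (- real m))) = real m" using assms by (simp add: ln_div ln_mult)
    ultimately show ?thesis by simp
  next
    case f: False
    then have "R / d \<le> exp (real m)" using d by (simp add: exp_minus field_simps)
    then have "ln (R / d) \<le> ln (exp (real m))" using d assms by (subst ln_le_cancel_iff) auto
    then have "ln (R / d) \<le> real m" by simp
    moreover have "max (R * exp (- real m)) (min R d) = min R d"
      using f assms by auto
    moreover have "min (max 0 (ln (R / d))) (real m) = ln (R / min R d)"
    proof (cases "d \<le> R")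
      case True
      then have "0 \<le> ln (R / d)" using assms d by simp
      then show ?thesis using True \<open>ln (R / d) \<le> real m\<close> by simp
    next
      case False
      then have "ln (R / d) \<le> 0" using assms d by simp
      then show ?thesis using False assms by simp
    qed
    ultimately show ?thesis by (simp only:)
  qed
  finally show ?thesis by (simp add: d_def)
qed

lemma SUP_min_of_nat_ennreal: "(SUP m. min (a::ennreal) (of_nat m)) = a"
proof -
  have "(SUP m. min a (of_nat m)) = inf a (SUP m. of_nat m)"
    by (simp add: inf_min[symmetric] inf_SUP)
  then show ?thesis by (simp add: ennreal_SUP_of_nat_eq_top)
qed

lemma continuous_on_min_log_kernel [continuous_intros]:
  assumes "R > 0" "continuous_on A f" "continuous_on A g"
  shows "continuous_on A (\<lambda>x. min (log_kernel R (f x) (g x)) (of_nat m))"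
proof -
  have "\<And>x. max (R * exp (- real m)) (min R \<bar>x\<bar>) > 0" for m
    using assms(1) by (simp add: less_max_iff_disj)
  then show ?thesis using assms
    unfolding min_log_kernel[OF assms(1)]
    by (intro continuous_on_ennreal continuous_intros) (auto simp: less_le)
qed

lemma measurable_log_kernel [measurable (raw)]:
  assumes [measurable]: "f \<in> borel_measurable M" "g \<in> borel_measurable M"
  shows "(\<lambda>x. log_kernel R (f x) (g x)) \<in> borel_measurable M"
  unfolding log_kernel_def by measurable

lemma measurable_potential [measurable]:
  assumes "sigma_finite_measure \<nu>" and [measurable_cong]: "sets \<nu> = sets borel"
  shows "potential R \<nu> \<in> borel_measurable borel"
proof -
  interpret sigma_finite_measure \<nu> by fact
  show ?thesis unfolding potential_def by measurable
qed

lemma potential_commute: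
  assumes "sigma_finite_measure \<nu>" "sets \<nu> = sets borel"
    "sigma_finite_measure \<sigma>" "sets \<sigma> = sets borel"
  shows "(\<integral>\<^sup>+x. potential R \<nu> x \<partial>\<sigma>) = (\<integral>\<^sup>+y. potential R \<sigma> y \<partial>\<nu>)"
proof -
  interpret pair_sigma_finite \<sigma> \<nu>
    using assms by (simp add: pair_sigma_finite_def)
  note [measurable_cong] = assms(2,4)
  show ?thesis unfolding potential_def
    by (subst Fubini') (auto simp: log_kernel_commute)
qed

section \<open>Truncated potentials and lower semicontinuity\<close>

lemma continuous_nn_integral_ennreal:
  fixes f :: "real \<Rightarrow> 'a \<Rightarrow> ennreal"
  assumes "finite_measure \<nu>" and [measurable]: "\<And>x. f x \<in> borel_measurable \<nu>"
    and "\<And>x y. f x y \<le> of_nat m" and "\<And>y. continuous_on UNIV (\<lambda>x. f x y)"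
  shows "continuous_on UNIV (\<lambda>x. \<integral>\<^sup>+y. f x y \<partial>\<nu>)"
proof (rule continuous_on_sequentiallyI)
  interpret finite_measure \<nu> by fact
  fix u :: "nat \<Rightarrow> real" and a assume u: "u \<longlonglongrightarrow> a"
  show "(\<lambda>n. \<integral>\<^sup>+y. f (u n) y \<partial>\<nu>) \<longlonglongrightarrow> (\<integral>\<^sup>+y. f a y \<partial>\<nu>)"
  proof (rule nn_integral_dominated_convergence[where w="\<lambda>_. of_nat m"])
    show "(\<integral>\<^sup>+y. of_nat m \<partial>\<nu>) < \<infinity>"
      by (simp add: ennreal_mult_less_top less_top[symmetric] emeasure_finite ennreal_mult_eq_top_iff)
    show "AE y in \<nu>. (\<lambda>n. f (u n) y) \<longlonglongrightarrow> f a y"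
    proof (rule AE_I2)
      fix y show "(\<lambda>n. f (u n) y) \<longlonglongrightarrow> f a y"
        using continuous_on_tendsto_compose[OF assms(4)[of y] u] by simp
    qed
  qed (use assms(2,3) in simp_all)
qed

text \<open>Lower semicontinuity: the tail above height \<open>m\<close> is a supremum over
  \<open>l\<close> of functions continuous in \<open>x\<close>, so its sublevel set is an
  intersection of closed sets. The case \<open>m = 0\<close> is the full potential.\<close>

lemma closed_log_kernel_tail_le:
  assumes "R > 0" "finite_measure \<nu>" "sets \<nu> = sets borel"
  shows "closed {x. (\<integral>\<^sup>+y. log_kernel R x y - min (log_kernel R x y) (of_nat m) \<partial>\<nu>) \<le> c}"
proof -
  note [measurable_cong] = assms(3)
  let ?k = "\<lambda>m x y. min (log_kernel R x y) (of_nat m)"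
  have eq: "(\<integral>\<^sup>+y. log_kernel R x y - ?k m x y \<partial>\<nu>) = (SUP l. \<integral>\<^sup>+y. ?k l x y - ?k m x y \<partial>\<nu>)" for x
  proof (subst nn_integral_monotone_convergence_SUP[symmetric])
    show "incseq (\<lambda>l y. ?k l x y - ?k m x y)"
      by (intro incseq_SucI le_funI ennreal_minus_mono min.mono order_refl) simp
    have "log_kernel R x y - ?k m x y = (SUP l. ?k l x y - ?k m x y)" for y
      using SUP_diff_ennreal[of "?k m x y" "\<lambda>l. ?k l x y" UNIV]
      by (simp add: SUP_min_of_nat_ennreal min_less_iff_disj of_nat_less_top)
    then show "(\<integral>\<^sup>+y. log_kernel R x y - ?k m x y \<partial>\<nu>) = (\<integral>\<^sup>+y. (SUP l. ?k l x y - ?k m x y) \<partial>\<nu>)"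
      by simp
  qed measurable
  have cont: "continuous_on UNIV (\<lambda>x. \<integral>\<^sup>+y. ?k l x y - ?k m x y \<partial>\<nu>)" for l
  proof (rule continuous_nn_integral_ennreal[OF assms(2), where m=l])
    have fin: "?k m x y \<noteq> \<top>" for m x y
      by (rule neq_top_trans[OF _ min.cobounded2]) simp
    show "continuous_on UNIV (\<lambda>x. ?k l x y - ?k m x y)" for y
      by (rule continuous_on_diff_ennreal[OF continuous_on_min_log_kernel continuous_on_min_log_kernel])
        (rule assms(1) continuous_on_id continuous_on_const fin)+
    show "?k l x y - ?k m x y \<le> of_nat l" for x y
      by (meson diff_le_self_ennreal min.cobounded2 order_trans)
  qed measurable
  have "{x. (\<integral>\<^sup>+y. log_kernel R x y - ?k m x y \<partial>\<nu>) \<le> c} =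
      (\<Inter>l. {x. (\<integral>\<^sup>+y. ?k l x y - ?k m x y \<partial>\<nu>) \<le> c})"
    unfolding eq by (auto simp: SUP_le_iff)
  also have "closed \<dots>"
    by (intro closed_INT ballI closed_Collect_le cont continuous_on_const)
  finally show ?thesis .
qed

lemma closed_potential_le:
  assumes "R > 0" "finite_measure \<nu>" "sets \<nu> = sets borel"
  shows "closed {x. potential R \<nu> x \<le> c}"
  using closed_log_kernel_tail_le[OF assms, of 0 c] by (simp add: potential_def min_absorb2)

section \<open>Positive definiteness of the kernel\<close>

text \<open>The integrand is the plateau \<open>R - d\<close> up to \<open>s = 1/R\<close>, then
  \<open>1/s - d\<close> up to \<open>s = 1/d\<close>, then 0 by truncation in
  \<open>ennreal\<close>. The two areas are \<open>(R - d)/R\<close> and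
  \<open>ln (R/d) - (R - d)/R\<close>.\<close>

lemma nn_integral_tent_width:
  assumes "R > 0" "0 < d" "d \<le> R"
  shows "(\<integral>\<^sup>+s. indicator {0<..} s * ennreal (min (1 / s) R - d) \<partial>lborel) = ennreal (ln (R / d))"
proof -
  have le: "1 / R \<le> 1 / d" using assms by (simp add: frac_le)
  have i1: "(\<integral>\<^sup>+s. ennreal (R - d) * indicator {0..1/R} s \<partial>lborel) = ennreal ((R - d) / R)"
    using assms by (simp add: nn_integral_cmult_indicator ennreal_mult[symmetric])
  have i2: "(\<integral>\<^sup>+s. ennreal (1 / s - d) * indicator {1/R..1/d} s \<partial>lborel) =
      ennreal ((ln (1/d) - d * (1/d)) - (ln (1/R) - d * (1/R)))"
  proof (rule nn_integral_FTC_Icc[where F="\<lambda>s. ln s - d * s", OF _ _ _ le])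
    fix s assume s: "s \<in> {1/R..1/d}"
    then have "1/R \<le> s" by simp
    then have "s > 0" using assms by (meson divide_pos_pos less_le_trans zero_less_one)
    then show "((\<lambda>s. ln s - d * s) has_real_derivative 1 / s - d) (at s)"
      by (auto intro!: derivative_eq_intros simp: divide_inverse)
    show "0 \<le> 1 / s - d" using s assms \<open>s > 0\<close> by (simp add: field_simps)
  qed auto
  have "AE s in lborel. s \<noteq> 0 \<and> s \<noteq> 1/R"
    using AE_lborel_singleton[of "0::real"] AE_lborel_singleton[of "1/R"] by eventually_elim auto
  then have "(\<integral>\<^sup>+s. indicator {0<..} s * ennreal (min (1 / s) R - d) \<partial>lborel) =
    (\<integral>\<^sup>+s. ennreal (R - d) * indicator {0..1/R} s + ennreal (1 / s - d) * indicator {1/R..1/d} s \<partial>lborel)"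
  proof (intro nn_integral_cong_AE, eventually_elim)
    fix s assume s: "s \<noteq> 0 \<and> s \<noteq> 1/R"
    consider "s < 0" | "0 < s" "s < 1/R" | "1/R < s" "s \<le> 1/d" | "1/d < s" using s by linarith
    then show "indicator {0<..} s * ennreal (min (1 / s) R - d) =
      ennreal (R - d) * indicator {0..1/R} s + ennreal (1 / s - d) * indicator {1/R..1/d} s"
    proof cases
      case 1
      then have "\<not> 1/R \<le> s" using assms by (smt (verit) divide_nonneg_pos)
      then show ?thesis using 1 by simp
    next
      case 2
      then have "R \<le> 1 / s" using assms by (simp add: field_simps)
      then show ?thesis using 2 by (simp add: min_def)
    next
      case 3
      then have "0 < s" using assms by (smt (verit) divide_nonneg_pos)
      moreover have "1 / s \<le> R" using 3 assms \<open>0 < s\<close> by (simp add: field_simps)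
      ultimately show ?thesis using 3 by (simp add: min_def)
    next
      case 4
      then have "0 < s" using assms by (smt (verit) divide_nonneg_pos)
      moreover have "1 / s \<le> d" using 4 assms \<open>0 < s\<close> by (simp add: field_simps)
      ultimately show ?thesis using 4 le by (simp add: min_def ennreal_neg)
    qed
  qed
  also have "\<dots> = ennreal ((R - d) / R) + ennreal ((ln (1/d) - d * (1/d)) - (ln (1/R) - d * (1/R)))"
    unfolding i1[symmetric] i2[symmetric] by (rule nn_integral_add) measurable
  also have "\<dots> = ennreal (ln (R / d))"
  proof -
    have g: "(ln (1/d) - d * (1/d)) - (ln (1/R) - d * (1/R)) = ln (R / d) - (R - d) / R"
      using assms by (simp add: ln_div field_simps)
    \<comment> \<open>The inequality shows that the second area is nonnegative, which is needed to
      add inside \<open>ennreal\<close>.\<close>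
    have "ln (d / R) \<le> d / R - 1" using assms by (intro ln_le_minus_one) simp
    then have "(R - d) / R \<le> ln (R / d)" using assms by (simp add: ln_div field_simps)
    then show ?thesis unfolding g using assms by (subst ennreal_plus[symmetric]) auto
  qed
  finally show ?thesis .
qed

text \<open>Lowering the integrand by \<open>d = R * exp (- n)\<close> leaves area \<open>n\<close>,
  and \<open>n\<close> is arbitrary. This matches the infinite value of the kernel on the
  diagonal.\<close>

lemma nn_integral_tent_width_0:
  assumes "R > 0"
  shows "(\<integral>\<^sup>+s. indicator {0<..} s * ennreal (min (1 / s) R) \<partial>lborel) = \<infinity>"
proof -
  have "of_nat n \<le> (\<integral>\<^sup>+s. indicator {0<..} s * ennreal (min (1 / s) R) \<partial>lborel)" for n
  proof -
    define d where "d = R * exp (- real n)"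
    have d: "0 < d" "d \<le> R" "ln (R / d) = real n" using assms by (simp_all add: d_def ln_div ln_mult)
    have "(\<integral>\<^sup>+s. indicator {0<..} s * ennreal (min (1 / s) R - d) \<partial>lborel)
       \<le> (\<integral>\<^sup>+s. indicator {0<..} s * ennreal (min (1 / s) R) \<partial>lborel)"
      using d by (intro nn_integral_mono mult_left_mono ennreal_leI) auto
    then show ?thesis using nn_integral_tent_width[OF assms d(1,2)] d(3)
      by (simp add: ennreal_of_nat_eq_real_of_nat)
  qed
  then show ?thesis
    by (metis ennreal_SUP_of_nat_eq_top SUP_least infinity_ennreal_def top.extremum_uniqueI)
qed

text \<open>The two windows of length \<open>min (1 / s) R\<close> starting at \<open>x\<close> and at \<open>y\<close> overlap in length
  \<open>(min (1 / s) R - \<bar>x - y\<bar>)\<^sup>+\<close>; integrating over all scales gives the logarithmic kernel,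
  which is thereby exhibited as positive definite.\<close>

definition window :: "real \<Rightarrow> real \<Rightarrow> real \<times> real \<Rightarrow> ennreal" where
  "window R x w = indicator {(x, s, u). 0 < s \<and> x \<le> u \<and> u \<le> x + min (1 / s) R} (x, w)"

lemma measurable_window [measurable (raw)]:
  assumes [measurable]: "f \<in> borel_measurable M" "g \<in> M \<rightarrow>\<^sub>M borel \<Otimes>\<^sub>M borel"
  shows "(\<lambda>x. window R (f x) (g x)) \<in> borel_measurable M"
  unfolding window_def indicator_def by simp measurable

lemma log_kernel_eq_window:
  assumes "R > 0" "\<bar>x - y\<bar> \<le> R"
  shows "log_kernel R x y = (\<integral>\<^sup>+w. window R x w * window R y w \<partial>(lborel \<Otimes>\<^sub>M lborel))"
proof -
  let ?d = "\<bar>x - y\<bar>"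
  have "(\<integral>\<^sup>+w. window R x w * window R y w \<partial>(lborel \<Otimes>\<^sub>M lborel)) =
    (\<integral>\<^sup>+s. \<integral>\<^sup>+u. window R x (s, u) * window R y (s, u) \<partial>lborel \<partial>lborel)"
    by (rule lborel.nn_integral_fst[symmetric]) measurable
  also have "\<dots> = (\<integral>\<^sup>+s. indicator {0<..} s * ennreal (min (1 / s) R - ?d) \<partial>lborel)"
  proof (rule nn_integral_cong)
    fix s :: real
    let ?L = "min (1 / s) R"
    have "(\<integral>\<^sup>+u. window R x (s, u) * window R y (s, u) \<partial>lborel) =
      (\<integral>\<^sup>+u. indicator {0<..} s * indicator {max x y .. min x y + ?L} u \<partial>lborel)"
      by (intro nn_integral_cong) (auto simp: window_def indicator_def)
    also have "\<dots> = indicator {0<..} s * ennreal (?L - ?d)"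
      by (auto simp: nn_integral_cmult_indicator emeasure_lborel_Icc_eq ennreal_neg max_def min_def
          intro!: arg_cong[where f=ennreal] split: split_indicator)
    finally show "(\<integral>\<^sup>+u. window R x (s, u) * window R y (s, u) \<partial>lborel) = \<dots>" .
  qed
  also have "\<dots> = log_kernel R x y"
    using assms nn_integral_tent_width[of R ?d] nn_integral_tent_width_0[of R]
    by (auto simp: log_kernel_def)
  finally show ?thesis by simp
qed

text \<open>For \<open>w = (s, u)\<close> with \<open>s > 0\<close> this is the \<nu>-mass of the
  interval from \<open>u - min (1/s) R\<close> to \<open>u\<close>.\<close>

definition window_mass :: "real \<Rightarrow> real measure \<Rightarrow> real \<times> real \<Rightarrow> ennreal" where
  "window_mass R \<nu> w = (\<integral>\<^sup>+x. window R x w \<partial>\<nu>)"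

lemma measurable_window_mass [measurable]:
  assumes "prob_space \<nu>" and [measurable_cong]: "sets \<nu> = sets borel"
  shows "window_mass R \<nu> \<in> borel_measurable (lborel \<Otimes>\<^sub>M lborel)"
proof -
  interpret prob_space \<nu> by fact
  show ?thesis unfolding window_mass_def by measurable
qed

lemma window_mass_le_1:
  assumes "prob_space \<nu>" shows "window_mass R \<nu> w \<le> 1"
proof -
  interpret prob_space \<nu> by fact
  have "window_mass R \<nu> w \<le> (\<integral>\<^sup>+x. 1 \<partial>\<nu>)"
    unfolding window_mass_def by (intro nn_integral_mono) (auto simp: window_def indicator_def)
  then show ?thesis by (simp add: emeasure_space_1)
qed

text \<open>Tonelli turns the mutual energy into an L2 inner product of window masses, so energies
  become squared norms. Confinement to an interval of length \<open>R\<close> keeps all distances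
  within the range of \<open>log_kernel_eq_window\<close>.\<close>

lemma mutual_energy_eq_window_mass:
  assumes "R > 0" "prob_space \<nu>" "sets \<nu> = sets borel" "prob_space \<sigma>" "sets \<sigma> = sets borel"
    and "AE x in \<nu>. x \<in> {-R/2..R/2}" "AE x in \<sigma>. x \<in> {-R/2..R/2}"
  shows "(\<integral>\<^sup>+x. potential R \<sigma> x \<partial>\<nu>) =
    (\<integral>\<^sup>+w. window_mass R \<nu> w * window_mass R \<sigma> w \<partial>(lborel \<Otimes>\<^sub>M lborel))"
proof -
  interpret n: prob_space \<nu> by fact
  interpret s: prob_space \<sigma> by fact
  interpret L: sigma_finite_measure "lborel \<Otimes>\<^sub>M lborel :: (real \<times> real) measure"
    by (rule sigma_finite_pair_measure) (rule lborel.sigma_finite_measure_axioms)+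
  interpret nL: pair_sigma_finite \<nu> "lborel \<Otimes>\<^sub>M lborel :: (real \<times> real) measure" ..
  interpret sL: pair_sigma_finite \<sigma> "lborel \<Otimes>\<^sub>M lborel :: (real \<times> real) measure" ..
  note [measurable_cong] = assms(3,5) sets_pair_measure_cong[OF sets_lborel sets_lborel]
  note [measurable] = measurable_window_mass[OF assms(2,3)] measurable_window_mass[OF assms(4,5)]
  have "(\<integral>\<^sup>+x. potential R \<sigma> x \<partial>\<nu>) =
    (\<integral>\<^sup>+x. \<integral>\<^sup>+w. window R x w * window_mass R \<sigma> w \<partial>(lborel \<Otimes>\<^sub>M lborel) \<partial>\<nu>)"
  proof (rule nn_integral_cong_AE, use assms(6) in eventually_elim)
    fix x assume x: "x \<in> {-R/2..R/2}"
    have "potential R \<sigma> x =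
        (\<integral>\<^sup>+y. \<integral>\<^sup>+w. window R x w * window R y w \<partial>(lborel \<Otimes>\<^sub>M lborel) \<partial>\<sigma>)"
      unfolding potential_def
    proof (rule nn_integral_cong_AE, use assms(7) in eventually_elim)
      fix y assume "y \<in> {-R/2..R/2}"
      then show "log_kernel R x y = (\<integral>\<^sup>+w. window R x w * window R y w \<partial>(lborel \<Otimes>\<^sub>M lborel))"
        using x assms(1) by (intro log_kernel_eq_window) auto
    qed
    also have "\<dots> = (\<integral>\<^sup>+w. \<integral>\<^sup>+y. window R x w * window R y w \<partial>\<sigma> \<partial>(lborel \<Otimes>\<^sub>M lborel))"
      by (rule sL.Fubini'[symmetric]) measurable
    also have "\<dots> = (\<integral>\<^sup>+w. window R x w * window_mass R \<sigma> w \<partial>(lborel \<Otimes>\<^sub>M lborel))"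
      unfolding window_mass_def 
      by (intro nn_integral_cong nn_integral_cmult) (measurable, simp add: space_pair_measure)
    finally show "potential R \<sigma> x = \<dots>" .
  qed
  also have "\<dots> = (\<integral>\<^sup>+w. \<integral>\<^sup>+x. window R x w * window_mass R \<sigma> w \<partial>\<nu> \<partial>(lborel \<Otimes>\<^sub>M lborel))"
    by (rule nL.Fubini'[symmetric]) measurable
  also have "\<dots> = (\<integral>\<^sup>+w. window_mass R \<nu> w * window_mass R \<sigma> w \<partial>(lborel \<Otimes>\<^sub>M lborel))"
    unfolding window_mass_def[of R \<nu>] 
    by (intro nn_integral_cong nn_integral_multc) (measurable, simp add: space_pair_measure)
  finally show ?thesis .
qed

text \<open>This is the equality case of Cauchy-Schwarz: expanding the square bounds the integral of
  \<open>(f - g)^2\<close> by \<open>V + V - 2 * V\<close>. To stay within \<open>ennreal\<close>,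
  the mixed term is moved to the left and the finite \<open>V + V\<close> is cancelled.\<close>

lemma AE_eq_of_nn_integral_square:
  fixes f g :: "'a \<Rightarrow> real"
  assumes [measurable]: "f \<in> borel_measurable M" "g \<in> borel_measurable M"
    and nonneg: "\<And>x. 0 \<le> f x" "\<And>x. 0 \<le> g x"
    and "(\<integral>\<^sup>+x. f x * f x \<partial>M) \<le> ennreal V" "(\<integral>\<^sup>+x. g x * g x \<partial>M) \<le> ennreal V"
    and "ennreal V \<le> (\<integral>\<^sup>+x. f x * g x \<partial>M)"
  shows "AE x in M. f x = g x"
proof -
  let ?D = "\<integral>\<^sup>+x. (f x - g x)\<^sup>2 \<partial>M" and ?C = "\<integral>\<^sup>+x. f x * g x \<partial>M"
  have "?C + ?C + ?D = (\<integral>\<^sup>+x. ennreal (f x * g x) + ennreal (f x * g x) + ennreal ((f x - g x)\<^sup>2) \<partial>M)"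
    by (simp add: nn_integral_add)
  also have "\<dots> = (\<integral>\<^sup>+x. ennreal (f x * f x) + ennreal (g x * g x) \<partial>M)"
  proof (rule nn_integral_cong)
    fix x
    have "f x * g x + f x * g x + (f x - g x)\<^sup>2 = f x * f x + g x * g x"
      by (simp add: power2_eq_square algebra_simps)
    then show "ennreal (f x * g x) + ennreal (f x * g x) + ennreal ((f x - g x)\<^sup>2) =
        ennreal (f x * f x) + ennreal (g x * g x)"
      by (metis ennreal_plus add_nonneg_nonneg mult_nonneg_nonneg nonneg zero_le_power2)
  qed
  also have "\<dots> = (\<integral>\<^sup>+x. f x * f x \<partial>M) + (\<integral>\<^sup>+x. g x * g x \<partial>M)"
    by (simp add: nn_integral_add)
  also have "\<dots> \<le> ennreal V + ennreal V" using assms by (intro add_mono)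
  finally have le: "?C + ?C + ?D \<le> ennreal V + ennreal V" .
  have "ennreal V + ennreal V + ?D \<le> ?C + ?C + ?D" using assms by (intro add_mono) auto
  then have "ennreal V + ennreal V + ?D \<le> ennreal V + ennreal V" using le by (rule order_trans)
  then have "?D \<le> 0"
    using ennreal_add_left_cancel_le[of "ennreal V + ennreal V" ?D 0] by simp
  then have "AE x in M. ennreal ((f x - g x)\<^sup>2) = 0"
    by (subst nn_integral_0_iff_AE[symmetric]) auto
  then show ?thesis by eventually_elim (auto simp: ennreal_eq_0_iff)
qed

section \<open>From equal window masses to equal measures\<close>

lemma emeasure_eq_0_of_AE_notin:
  assumes "AE x in M. x \<notin> A" "A \<in> sets M"
  shows "emeasure M A = 0"
  using assms AE_iff_null_sets null_setsD1 by blast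

text \<open>Outside \<open>{a..<b}\<close> both distribution functions are 0 or 1. Inside, a set of
  full Lebesgue measure meets every interval to the right of \<open>u\<close>, and right continuity
  transfers the equality to \<open>u\<close> itself.\<close>

lemma cdf_eq_of_AE:
  assumes "real_distribution \<nu>" "real_distribution \<sigma>" "a < b"
    and "AE x in \<nu>. x \<in> {a..b}" "AE x in \<sigma>. x \<in> {a..b}"
    and "AE u in lborel. u \<in> {a..b} \<longrightarrow> cdf \<nu> u = cdf \<sigma> u"
  shows "\<nu> = \<sigma>"
proof (rule cdf_unique[OF assms(1,2)], rule ext)
  interpret n: real_distribution \<nu> by fact
  interpret s: real_distribution \<sigma> by fact
  fix u
  have lo: "cdf M u = 0" if "u < a" "real_distribution M" "AE x in M. x \<in> {a..b}" for M
  proof -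
    interpret real_distribution M by fact
    have "AE x in M. x \<notin> {..u}" using that(3) by eventually_elim (use that(1) in auto)
    then have "emeasure M {..u} = 0"
      by (intro emeasure_eq_0_of_AE_notin) auto
    then show ?thesis by (simp add: cdf_def measure_def)
  qed
  have hi: "cdf M u = 1" if "b \<le> u" "real_distribution M" "AE x in M. x \<in> {a..b}" for M
  proof -
    interpret real_distribution M by fact
    have "AE x in M. x \<in> {..u}" using that(3) by eventually_elim (use that(1) in auto)
    then have "prob {..u} = 1" by (subst (asm) AE_in_set_eq_1) auto
    then show ?thesis by (simp add: cdf_def)
  qed
  show "cdf \<nu> u = cdf \<sigma> u"
  proof (cases "u < a \<or> b \<le> u")
    case True then show ?thesis using lo hi assms by auto
  next
    case False
    have "\<exists>v. u < v \<and> v < u + e \<and> cdf \<nu> v = cdf \<sigma> v" if "e > 0" for e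
    proof (rule ccontr)
      assume "\<not> ?thesis"
      then have "AE v in lborel. v \<notin> {u<..<min b (u + e)}"
        using assms(6) False by (auto elim!: eventually_mono)
      then have "emeasure lborel {u<..<min b (u + e)} = 0"
        by (intro emeasure_eq_0_of_AE_notin) auto
      then show False using that False by (auto simp: min_def split: if_splits)
    qed
    then have "\<exists>v. u < v \<and> v < u + 1 / real (Suc i) \<and> cdf \<nu> v = cdf \<sigma> v" for i by simp
    then obtain v where v: "\<And>i. u < v i" "\<And>i. v i < u + 1 / real (Suc i)" "\<And>i. cdf \<nu> (v i) = cdf \<sigma> (v i)"
      by metis
    have "v \<longlonglongrightarrow> u"
    proof (rule tendsto_sandwich[of "\<lambda>_. u"])
      show "(\<lambda>i. u + 1 / real (Suc i)) \<longlonglongrightarrow> u"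
        using tendsto_add[OF tendsto_const LIMSEQ_inverse_real_of_nat, of u] by (simp add: inverse_eq_divide)
      show "eventually (\<lambda>i. v i \<le> u + 1 / real (Suc i)) sequentially"
        using v(2) less_imp_le by (intro always_eventually) blast
      show "eventually (\<lambda>i. u \<le> v i) sequentially"
        using v(1) less_imp_le by (intro always_eventually) blast
    qed simp
    then have lim: "filterlim v (at_right u) sequentially"
      using less_imp_neq[OF v(1), symmetric] v(1) by (auto simp: filterlim_at)
    have "(\<lambda>i. cdf \<nu> (v i)) \<longlonglongrightarrow> cdf \<nu> u"
      by (rule filterlim_compose[OF _ lim]) (use n.cdf_is_right_cont[of u] in \<open>simp add: continuous_within\<close>)
    moreover have "(\<lambda>i. cdf \<sigma> (v i)) \<longlonglongrightarrow> cdf \<sigma> u"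
      by (rule filterlim_compose[OF _ lim]) (use s.cdf_is_right_cont[of u] in \<open>simp add: continuous_within\<close>)
    ultimately show ?thesis using v(3) LIMSEQ_unique by auto
  qed
qed

text \<open>With both energies at most \<open>V\<close> and the mutual energy at least
  \<open>V\<close>, Cauchy-Schwarz is an equality, so the window masses agree at almost every scale
  and position. One coarse scale then recovers the distribution functions.\<close>

lemma equal_of_energy_le:
  assumes R: "R > 0" and nu: "prob_space \<nu>" "sets \<nu> = sets borel" and si: "prob_space \<sigma>" "sets \<sigma> = sets borel"
    and D: "AE x in \<nu>. x \<in> {-R/2..R/2}" "AE x in \<sigma>. x \<in> {-R/2..R/2}"
    and V: "(\<integral>\<^sup>+x. potential R \<nu> x \<partial>\<nu>) \<le> ennreal V" "(\<integral>\<^sup>+x. potential R \<sigma> x \<partial>\<sigma>) \<le> ennreal V"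
      "ennreal V \<le> (\<integral>\<^sup>+x. potential R \<sigma> x \<partial>\<nu>)"
  shows "\<nu> = \<sigma>"
proof -
  let ?L = "lborel \<Otimes>\<^sub>M lborel :: (real \<times> real) measure"
  have rd: "real_distribution \<nu>" "real_distribution \<sigma>"
    using nu si by (auto simp: real_distribution_def real_distribution_axioms_def dest: sets_eq_imp_space_eq)
  interpret n: real_distribution \<nu> by fact
  interpret s: real_distribution \<sigma> by fact
  note [measurable] = measurable_window_mass[OF nu] measurable_window_mass[OF si]
  define f where "f w = enn2real (window_mass R \<nu> w)" for w
  define g where "g w = enn2real (window_mass R \<sigma> w)" for w
  have f: "window_mass R \<nu> w = ennreal (f w)" for w
    using window_mass_le_1[OF nu(1), of R w] unfolding f_def
    by (intro ennreal_enn2real[symmetric]) (auto simp: less_top[symmetric] top_unique)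
  have g: "window_mass R \<sigma> w = ennreal (g w)" for w
    using window_mass_le_1[OF si(1), of R w] unfolding g_def
    by (intro ennreal_enn2real[symmetric]) (auto simp: less_top[symmetric] top_unique)
  have nn: "0 \<le> f w" "0 \<le> g w" for w by (simp_all add: f_def g_def)
  have "AE w in ?L. f w = g w"
  proof (rule AE_eq_of_nn_integral_square[where V=V])
    show "f \<in> borel_measurable ?L" "g \<in> borel_measurable ?L" unfolding f_def g_def by measurable
    show "(\<integral>\<^sup>+w. f w * f w \<partial>?L) \<le> ennreal V" using V(1)
      unfolding mutual_energy_eq_window_mass[OF R nu nu D(1,1)] f by (simp add: ennreal_mult nn)
    show "(\<integral>\<^sup>+w. g w * g w \<partial>?L) \<le> ennreal V" using V(2)
      unfolding mutual_energy_eq_window_mass[OF R si si D(2,2)] g by (simp add: ennreal_mult nn)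
    show "ennreal V \<le> (\<integral>\<^sup>+w. f w * g w \<partial>?L)" using V(3)
      unfolding mutual_energy_eq_window_mass[OF R nu si D(1,2)] f g by (simp add: ennreal_mult nn)
  qed (use nn in auto)
  then have AE: "AE s in lborel. AE u in lborel. f (s, u) = g (s, u)"
    by (rule lborel_pair.AE_pair)
  obtain s where s: "0 < s" "s < 1 / R" "AE u in lborel. f (s, u) = g (s, u)"
  proof (rule ccontr)
    assume "\<not> thesis"
    then have "AE s in lborel. s \<notin> {0<..<1/R}"
      using AE that by (auto elim!: eventually_mono)
    then have "emeasure lborel {0<..<1/R} = 0"
      by (intro emeasure_eq_0_of_AE_notin) auto
    then show False using R by simp
  qed
  \<comment> \<open>At a scale below \<open>1/R\<close> the window has full length \<open>R\<close>.
    From any \<open>u\<close> in the interval it reaches back to \<open>-R/2\<close> or beyond, so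
    its mass is the distribution function at \<open>u\<close>.\<close>
  have ms: "min (1 / s) R = R" using s R by (simp add: min_def field_simps)
  have cdf: "window_mass R M (s, u) = ennreal (cdf M u)"
    if "real_distribution M" "AE x in M. x \<in> {-R/2..R/2}" "u \<in> {-R/2..R/2}" for u M
  proof -
    interpret real_distribution M by fact
    have "window_mass R M (s, u) = (\<integral>\<^sup>+x. indicator {..u} x \<partial>M)"
      unfolding window_mass_def
    proof (rule nn_integral_cong_AE, use that(2) in eventually_elim)
      fix x assume "x \<in> {-R/2..R/2}"
      then show "window R x (s, u) = indicator {..u} x"
        using that(3) s(1) ms by (auto simp: window_def indicator_def)
    qed
    then show ?thesis by (simp add: cdf_def emeasure_eq_measure)
  qed
  show ?thesis
  proof (rule cdf_eq_of_AE[OF rd _ D])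
    show "AE u in lborel. u \<in> {-R/2..R/2} \<longrightarrow> cdf \<nu> u = cdf \<sigma> u"
      using s(3)
    proof eventually_elim
      fix u assume "f (s, u) = g (s, u)"
      then show "u \<in> {-R/2..R/2} \<longrightarrow> cdf \<nu> u = cdf \<sigma> u"
        using cdf[OF rd(1) D(1)] cdf[OF rd(2) D(2)]
        by (auto simp: f_def g_def n.cdf_nonneg s.cdf_nonneg)
    qed
  qed (use R in simp)
qed

section \<open>The maximum principle\<close>

lemma log_kernel_mono_dist:
  assumes "R > 0" "\<bar>x' - y\<bar> \<le> \<bar>x - y\<bar>"
  shows "log_kernel R x y \<le> log_kernel R x' y"
  using assms by (auto simp: log_kernel_def intro!: ennreal_leI divide_left_mono)

lemma log_kernel_strict_mono_dist:
  assumes "R > 0" "\<bar>x' - y\<bar> < \<bar>x - y\<bar>" "\<bar>x - y\<bar> \<le> R"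
  shows "log_kernel R x y < log_kernel R x' y"
proof (cases "x' = y")
  case True
  then show ?thesis using assms by (auto simp: log_kernel_def less_top[symmetric])
next
  case False
  have "ln (R / \<bar>x - y\<bar>) < ln (R / \<bar>x' - y\<bar>)" "0 \<le> ln (R / \<bar>x - y\<bar>)"
    using assms False by (auto simp: divide_strict_left_mono)
  then show ?thesis using assms False by (auto simp: log_kernel_def intro!: ennreal_lessI)
qed

text \<open>Seen from \<open>y\<close> outside the open interval, \<open>\<bar>x - y\<bar>\<close>
  is affine for \<open>x\<close> between \<open>a\<close> and \<open>b\<close>, and
  \<open>- ln\<close> is strictly convex. If \<open>y\<close> is an end point, the right side is
  infinite.\<close>

lemma log_kernel_strict_convex:
  assumes R: "R > 0" and x: "a < x" "x < b" and y: "y \<le> a \<or> b \<le> y"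
    and le: "\<bar>a - y\<bar> \<le> R" "\<bar>b - y\<bar> \<le> R"
  shows "log_kernel R x y <
    ennreal ((b - x) / (b - a)) * log_kernel R a y + ennreal ((x - a) / (b - a)) * log_kernel R b y"
proof (cases "y = a \<or> y = b")
  case True
  have "log_kernel R x y < \<infinity>" using x True by (auto simp: log_kernel_def)
  moreover have "(b - x) / (b - a) > 0" "(x - a) / (b - a) > 0" using x by simp_all
  ultimately show ?thesis using True
    by (auto simp: log_kernel_def ennreal_mult_top)
next
  case False
  define s where "s = (b - x) / (b - a)"
  define t where "t = (x - a) / (b - a)"
  have st: "0 < s" "0 < t" "s + t = 1"
    using x by (simp_all add: s_def t_def add_divide_distrib[symmetric])
  have "s * a + t * b = (x * (b - a)) / (b - a)"
    unfolding s_def t_def by (simp add: add_divide_distrib[symmetric] algebra_simps)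
  then have sx: "s * a + t * b = x" using x by simp
  define p where "p = \<bar>a - y\<bar>"
  define q where "q = \<bar>b - y\<bar>"
  define d where "d = \<bar>x - y\<bar>"
  have pos: "0 < p" "0 < q" "0 < d" using False x y by (auto simp: p_def q_def d_def)
  have d: "d = s * p + t * q"
  proof -
    have "s * (a - y) + t * (b - y) = (s * a + t * b) - (s + t) * y" by (simp add: algebra_simps)
    then have "x - y = s * (a - y) + t * (b - y)" using st(3) sx by simp
    moreover have "\<bar>s * (a - y) + t * (b - y)\<bar> = s * \<bar>a - y\<bar> + t * \<bar>b - y\<bar>"
    proof (cases "y \<le> a")
      case True
      then show ?thesis using x st by (subst abs_of_nonneg) auto
    next
      case False
      then have "a - y \<le> 0" "b - y \<le> 0" using x y by auto
      then have "s * (a - y) \<le> 0" "t * (b - y) \<le> 0" using st by (simp_all add: mult_nonneg_nonpos)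
      then show ?thesis using \<open>a - y \<le> 0\<close> \<open>b - y \<le> 0\<close> by (simp add: abs_of_nonpos algebra_simps)
    qed
    ultimately show ?thesis by (simp add: d_def p_def q_def)
  qed
  \<comment> \<open>Strict convexity comes from \<open>ln v \<le> v - 1\<close> at
    \<open>v = p/d\<close> and \<open>v = q/d\<close>. Equality requires \<open>v = 1\<close>, which
    is excluded for the first ratio.\<close>
  have "p \<noteq> d" using x y by (auto simp: p_def d_def)
  have "ln (p / d) \<noteq> p / d - 1"
    using ln_eq_minus_one[of "p / d"] pos \<open>p \<noteq> d\<close> by auto
  then have lp: "ln (p / d) < p / d - 1" using ln_le_minus_one[of "p / d"] pos by auto
  have lq: "ln (q / d) \<le> q / d - 1" using pos by (intro ln_le_minus_one) simp
  have "s * ln (p / d) + t * ln (q / d) < s * (p / d - 1) + t * (q / d - 1)"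
    using lp lq st by (intro add_less_le_mono mult_strict_left_mono mult_left_mono) auto
  also have "\<dots> = (s * p + t * q) / d - (s + t)"
    by (simp add: algebra_simps add_divide_distrib)
  also have "\<dots> = 0" using pos st by (simp add: d[symmetric])
  finally have "s * (ln p - ln d) + t * (ln q - ln d) < 0" using pos by (simp add: ln_div)
  moreover have "s * (ln R - ln p) + t * (ln R - ln q) =
      (s + t) * (ln R - ln d) - (s * (ln p - ln d) + t * (ln q - ln d))"
    by (simp add: algebra_simps)
  ultimately have "ln (R / d) < s * ln (R / p) + t * ln (R / q)"
    using pos st(3) R by (simp add: ln_div)
  moreover have nn: "0 \<le> ln (R / p)" "0 \<le> ln (R / q)"
    using pos le R by (simp_all add: p_def q_def)
  moreover have "0 \<le> ln (R / d)"
  proof -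
    have "d \<le> s * R + t * R" unfolding d using st le
      by (intro add_mono mult_left_mono) (auto simp: p_def q_def)
    then have "d \<le> R" using st by (metis distrib_right mult_1)
    then show ?thesis using pos R by simp
  qed
  ultimately have "ennreal (ln (R / d)) < ennreal (s * ln (R / p) + t * ln (R / q))"
    by (intro ennreal_lessI) auto
  also have "\<dots> = ennreal s * ennreal (ln (R / p)) + ennreal t * ennreal (ln (R / q))"
    using st nn by (simp add: ennreal_mult)
  finally show ?thesis using False x pos
    by (auto simp: log_kernel_def s_def t_def p_def q_def d_def)
qed

lemma nn_integral_strict_mono_AE:
  assumes [measurable]: "f \<in> borel_measurable M" "g \<in> borel_measurable M"
    and "(\<integral>\<^sup>+x. f x \<partial>M) \<noteq> \<infinity>" "AE x in M. f x < g x" "emeasure M (space M) \<noteq> 0"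
  shows "(\<integral>\<^sup>+x. f x \<partial>M) < (\<integral>\<^sup>+x. g x \<partial>M)"
proof (rule nn_integral_less)
  show "AE x in M. f x \<le> g x" using assms(4) by eventually_elim simp
  show "\<not> (AE x in M. g x \<le> f x)"
  proof
    assume "AE x in M. g x \<le> f x"
    then have "AE x in M. False" using assms(4) by eventually_elim auto
    then have "ae_filter M = bot" by (simp add: trivial_limit_def)
    then show False using assms(5) by (simp add: ae_filter_eq_bot_iff)
  qed
qed (use assms in auto)

text \<open>On the real line the maximum principle is convexity: the potential is strictly convex on the gaps
  of a carrier \<open>S\<close> and strictly monotone beyond its end points.\<close>

lemma potential_less_off_carrier:
  assumes R: "R > 0" and rho: "prob_space \<rho>" "sets \<rho> = sets borel"
    and S: "closed S" "S \<subseteq> {-R/2..R/2}" "AE y in \<rho>. y \<in> S"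
    and V: "\<And>x. x \<in> S \<Longrightarrow> potential R \<rho> x \<le> V" "V < \<infinity>"
    and x: "x \<in> {-R/2..R/2}" "x \<notin> S"
  shows "potential R \<rho> x < V"
proof -
  interpret prob_space \<rho> by fact
  note [measurable_cong] = rho(2)
  have ne: "emeasure \<rho> (space \<rho>) \<noteq> 0" by (simp add: emeasure_space_1)
  have dist: "\<bar>u - v\<bar> \<le> R" if "u \<in> {-R/2..R/2}" "v \<in> {-R/2..R/2}" for u v
    using that by auto
  obtain e where e: "e > 0" "ball x e \<inter> S = {}"
    using S(1) x(2) by (metis Compl_iff open_Compl open_contains_ball disjoint_eq_subset_Compl)
  \<comment> \<open>A ball of radius \<open>e\<close> around \<open>x\<close> avoids
    \<open>S\<close>, which bounds the kernel and makes the potential at \<open>x\<close> finite.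
    Strict comparison of integrals requires this.\<close>
  have "potential R \<rho> x \<le> (\<integral>\<^sup>+y. ennreal (ln (R / e)) \<partial>\<rho>)"
    unfolding potential_def
  proof (rule nn_integral_mono_AE, use S(3) in eventually_elim)
    fix y assume "y \<in> S"
    then have "e \<le> \<bar>x - y\<bar>" using e(2) by (auto simp: dist_real_def disjoint_iff not_less)
    then show "log_kernel R x y \<le> ennreal (ln (R / e))"
      using e(1) R by (auto simp: log_kernel_def intro!: ennreal_leI divide_left_mono)
  qed
  then have fin: "potential R \<rho> x \<noteq> \<infinity>" by (auto simp: emeasure_space_1 top_unique)
  have "S \<noteq> {}"
  proof
    assume "S = {}"
    then have "ae_filter \<rho> = bot" using S(3) by (simp add: trivial_limit_def)
    then show False using ne by (simp add: ae_filter_eq_bot_iff)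
  qed
  \<comment> \<open>In the cases below \<open>g\<close> is the kernel seen from the nearest point of
    \<open>S\<close> or, in a gap, a convex combination of the kernels seen from its two ends. Its
    integral is at most \<open>V\<close> because these points belong to \<open>S\<close>.\<close>
  have key: "potential R \<rho> x < V"
    if [measurable]: "g \<in> borel_measurable borel" and "\<And>y. y \<in> S \<Longrightarrow> log_kernel R x y < g y"
      and "(\<integral>\<^sup>+y. g y \<partial>\<rho>) \<le> V" for g
  proof -
    have "potential R \<rho> x < (\<integral>\<^sup>+y. g y \<partial>\<rho>)"
      using fin unfolding potential_def
      by (intro nn_integral_strict_mono_AE ne) (use S(3) that(2) in \<open>auto elim!: eventually_mono\<close>)
    then show ?thesis using that(3) by simp
  qed
  have compact: "compact (S \<inter> {..x})" "compact (S \<inter> {x..})"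
    using S by (auto intro!: closed_Int simp: compact_eq_bounded_closed
        intro: bounded_subset[OF bounded_closed_interval])
  consider "S \<inter> {..x} = {}" | "S \<inter> {x..} = {}" | "S \<inter> {..x} \<noteq> {}" "S \<inter> {x..} \<noteq> {}" by blast
  then show ?thesis
  proof cases
    case 1
    then have "S \<inter> {x..} \<noteq> {}" using \<open>S \<noteq> {}\<close> by fastforce
    then obtain b where b: "b \<in> S" "x \<le> b" "\<And>y. y \<in> S \<Longrightarrow> x \<le> y \<Longrightarrow> b \<le> y"
      using compact_attains_inf[OF compact(2)] by auto
    show ?thesis
    proof (rule key)
      fix y assume y: "y \<in> S"
      then have "x < y" using 1 by fastforce
      moreover have "x < b" using b(1,2) x(2) by (auto simp: less_le)
      ultimately have "\<bar>b - y\<bar> < \<bar>x - y\<bar>" using b(3)[OF y] by simp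
      then show "log_kernel R x y < log_kernel R b y"
        using subsetD[OF S(2) y] x(1) by (intro log_kernel_strict_mono_dist R dist)
    qed (use V(1)[OF b(1)] in \<open>simp_all add: potential_def\<close>)
  next
    case 2
    then have "S \<inter> {..x} \<noteq> {}" using \<open>S \<noteq> {}\<close> by fastforce
    then obtain a where a: "a \<in> S" "a \<le> x" "\<And>y. y \<in> S \<Longrightarrow> y \<le> x \<Longrightarrow> y \<le> a"
      using compact_attains_sup[OF compact(1)] by auto
    show ?thesis
    proof (rule key)
      fix y assume y: "y \<in> S"
      then have "y < x" using 2 by fastforce
      moreover have "a < x" using a(1,2) x(2) by (auto simp: less_le)
      ultimately have "\<bar>a - y\<bar> < \<bar>x - y\<bar>" using a(3)[OF y] by simp
      then show "log_kernel R x y < log_kernel R a y"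
        using subsetD[OF S(2) y] x(1) by (intro log_kernel_strict_mono_dist R dist)
    qed (use V(1)[OF a(1)] in \<open>simp_all add: potential_def\<close>)
  next
    case 3
    obtain a where a: "a \<in> S" "a \<le> x" "\<And>y. y \<in> S \<Longrightarrow> y \<le> x \<Longrightarrow> y \<le> a"
      using compact_attains_sup[OF compact(1) 3(1)] by auto
    obtain b where b: "b \<in> S" "x \<le> b" "\<And>y. y \<in> S \<Longrightarrow> x \<le> y \<Longrightarrow> b \<le> y"
      using compact_attains_inf[OF compact(2) 3(2)] by auto
    have ab: "a < x" "x < b" using a b x by (auto simp: less_le)
    let ?s = "(b - x) / (b - a)" and ?t = "(x - a) / (b - a)"
    show ?thesis
    proof (rule key)
      fix y assume y: "y \<in> S"
      have "y \<le> a \<or> b \<le> y" using a(3)[OF y] b(3)[OF y] by linarith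
      then show "log_kernel R x y < ennreal ?s * log_kernel R a y + ennreal ?t * log_kernel R b y"
        using subsetD[OF S(2)] y a(1) b(1) by (intro log_kernel_strict_convex R ab dist) auto
    next
      have "(\<integral>\<^sup>+y. ennreal ?s * log_kernel R a y + ennreal ?t * log_kernel R b y \<partial>\<rho>) =
          ennreal ?s * potential R \<rho> a + ennreal ?t * potential R \<rho> b"
        by (simp add: nn_integral_add nn_integral_cmult potential_def)
      also have "\<dots> \<le> ennreal ?s * V + ennreal ?t * V"
        using V(1) a b by (intro add_mono mult_left_mono) auto
      also have "\<dots> = ennreal (?s + ?t) * V" using ab by (simp add: distrib_right)
      also have "?s + ?t = 1" using ab by (simp add: add_divide_distrib[symmetric])
      finally show "(\<integral>\<^sup>+y. ennreal ?s * log_kernel R a y + ennreal ?t * log_kernel R b y \<partial>\<rho>) \<le> V" by simp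
    qed measurable
  qed
qed

section \<open>The equilibrium measure\<close>

text \<open>Points of \<open>E\<close> are at distance at most \<open>R\<close>, so the kernel
  exceeds \<open>log (1/|x - y|)\<close> exactly by \<open>ln R\<close>, which is nonnegative as
  \<open>R \<ge> 1\<close>. To avoid \<open>\<infinity> - \<infinity>\<close>, the negative part is
  first added to both sides and subtracted only once it is known to be finite.\<close>

lemma log_energy_eq:
  assumes R: "R \<ge> 1" and E: "E \<subseteq> {-R/2..R/2}" and nu: "\<nu> \<in> prob_measures_on E" and mE: "E \<in> sets borel"
  shows "log_energy \<nu> = enn2ereal (\<integral>\<^sup>+x. potential R \<nu> x \<partial>\<nu>) - ereal (ln R)"
proof -
  have nu': "prob_space \<nu>" and [measurable_cong]: "sets \<nu> = sets borel" and "emeasure \<nu> E = 1"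
    using nu by (auto simp: prob_measures_on_def)
  interpret prob_space \<nu> by fact
  have AE_E: "AE x in \<nu>. x \<in> E"
    using \<open>emeasure \<nu> E = 1\<close> mE by (subst AE_in_set_eq_1) (auto simp: measure_def)
  define p where "p x y = (if x = y then \<infinity> else ennreal (max 0 (- ln \<bar>x - y\<bar>)))" for x y :: real
  define q where "q x y = ennreal (max 0 (ln \<bar>x - y\<bar>))" for x y :: real
  define J Q K where "J = (\<integral>\<^sup>+x. \<integral>\<^sup>+y. p x y \<partial>\<nu> \<partial>\<nu>)" and "Q = (\<integral>\<^sup>+x. \<integral>\<^sup>+y. q x y \<partial>\<nu> \<partial>\<nu>)"
    and "K = (\<integral>\<^sup>+x. potential R \<nu> x \<partial>\<nu>)"
  have [measurable]: "(\<lambda>x. p (f x) (g x)) \<in> borel_measurable M" "(\<lambda>x. q (f x) (g x)) \<in> borel_measurable M"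
    if [measurable]: "f \<in> borel_measurable M" "g \<in> borel_measurable M" for f g and M :: "'z measure"
    unfolding p_def q_def by measurable
  have pt: "log_kernel R x y + q x y = p x y + ennreal (ln R)" and ql: "q x y \<le> ennreal (ln R)"
    if "x \<in> E" "y \<in> E" for x y
  proof -
    have d: "\<bar>x - y\<bar> \<le> R" using subsetD[OF E that(1)] subsetD[OF E that(2)] by auto
    then have l: "x \<noteq> y \<Longrightarrow> ln \<bar>x - y\<bar> \<le> ln R" using R by (subst ln_le_cancel_iff) auto
    show "q x y \<le> ennreal (ln R)" using l R by (cases "x = y") (auto simp: q_def intro!: ennreal_leI)
    show "log_kernel R x y + q x y = p x y + ennreal (ln R)"
    proof (cases "x = y")
      case False
      have "log_kernel R x y + q x y = ennreal (ln R - ln \<bar>x - y\<bar> + max 0 (ln \<bar>x - y\<bar>))"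
        using False l R by (subst ennreal_plus) (auto simp: log_kernel_def q_def ln_div)
      also have "ln R - ln \<bar>x - y\<bar> + max 0 (ln \<bar>x - y\<bar>) = max 0 (- ln \<bar>x - y\<bar>) + ln R" by auto
      also have "ennreal \<dots> = p x y + ennreal (ln R)"
        using False R by (subst ennreal_plus) (auto simp: p_def)
      finally show ?thesis .
    qed (simp add: log_kernel_def p_def)
  qed
  have "K + Q = (\<integral>\<^sup>+x. \<integral>\<^sup>+y. log_kernel R x y + q x y \<partial>\<nu> \<partial>\<nu>)"
    unfolding K_def Q_def potential_def by (simp add: nn_integral_add)
  also have "\<dots> = (\<integral>\<^sup>+x. \<integral>\<^sup>+y. p x y + ennreal (ln R) \<partial>\<nu> \<partial>\<nu>)"
    by (intro nn_integral_cong_AE, use AE_E in eventually_elim, intro nn_integral_cong_AE,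
        use AE_E in eventually_elim) (rule pt)
  also have "\<dots> = J + ennreal (ln R)"
    unfolding J_def by (simp add: nn_integral_add emeasure_space_1)
  finally have eq: "K + Q = J + ennreal (ln R)" .
  have "Q \<le> (\<integral>\<^sup>+x. \<integral>\<^sup>+y. ennreal (ln R) \<partial>\<nu> \<partial>\<nu>)" unfolding Q_def
    by (intro nn_integral_mono_AE, use AE_E in eventually_elim, intro nn_integral_mono_AE,
        use AE_E in eventually_elim) (rule ql)
  then have "Q \<noteq> \<top>" by (auto simp: emeasure_space_1 top_unique)
  then obtain a where a: "Q = ennreal a" "a \<ge> 0" by (cases Q) auto
  have "enn2ereal K + ereal a = enn2ereal J + ereal (ln R)"
    using arg_cong[OF eq, of enn2ereal] a R by (simp add: plus_ennreal.rep_eq enn2ereal_ennreal)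
  then have "enn2ereal J - ereal a = enn2ereal K - ereal (ln R)"
    by (cases "enn2ereal J"; cases "enn2ereal K") auto
  then show ?thesis
    using a by (simp add: log_energy_def J_def Q_def K_def p_def q_def enn2ereal_ennreal)
qed

text \<open>If the potential of a minimizer exceeded its mean \<open>V\<close> on a set of positive mass, then it would be
  smaller than \<open>V\<close> on a set \<open>A\<close> of positive mass, and shifting mass to \<open>A\<close> would lower the energy.\<close>

lemma AE_potential_le_of_minimal:
  assumes R: "R > 0" and rho: "\<rho> \<in> prob_measures_on E" and E: "E \<in> sets borel"
    and V: "(\<integral>\<^sup>+x. potential R \<rho> x \<partial>\<rho>) = ennreal V" "V \<ge> 0"
    and min: "\<And>\<sigma>. \<sigma> \<in> prob_measures_on E \<Longrightarrow> ennreal V \<le> (\<integral>\<^sup>+x. potential R \<sigma> x \<partial>\<sigma>)"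
  shows "AE x in \<rho>. potential R \<rho> x \<le> ennreal V"
proof (rule ccontr)
  assume not: "\<not> ?thesis"
  have "prob_space \<rho>" and [measurable_cong]: "sets \<rho> = sets borel" and "emeasure \<rho> E = 1"
    using rho by (auto simp: prob_measures_on_def)
  interpret prob_space \<rho> by fact
  have sf: "sigma_finite_measure \<rho>" by (rule sigma_finite_measure_axioms)
  note [measurable] = measurable_potential[OF sf \<open>sets \<rho> = sets borel\<close>]
  have AE_E: "AE x in \<rho>. x \<in> E"
    using \<open>emeasure \<rho> E = 1\<close> E by (subst AE_in_set_eq_1) (auto simp: measure_def)
  define A where "A = {x. potential R \<rho> x < ennreal V}"
  have [measurable]: "A \<in> sets borel" unfolding A_def by measurable
  define al where "al = prob A"
  have al: "0 \<le> al" "al \<le> 1" by (simp_all add: al_def)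
  \<comment> \<open>If the potential were at least \<open>V\<close> almost everywhere, exceeding
    \<open>V\<close> on a set of positive mass would push its mean above \<open>V\<close>.\<close>
  have nA: "\<not> (AE x in \<rho>. x \<notin> A)"
  proof
    assume "AE x in \<rho>. x \<notin> A"
    then have "(\<integral>\<^sup>+x. ennreal V \<partial>\<rho>) < (\<integral>\<^sup>+x. potential R \<rho> x \<partial>\<rho>)"
      using not by (intro nn_integral_less) (auto simp: A_def not_less emeasure_space_1)
    then show False using V by (simp add: emeasure_space_1)
  qed
  \<comment> \<open>\<open>a\<close> is the mutual energy of \<rho> and its restriction to
    \<open>A\<close>; \<open>c\<close> below is the energy of that restriction.\<close>
  define a where "a = enn2real (\<integral>\<^sup>+x. potential R \<rho> x * indicator A x \<partial>\<rho>)"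
  have a_le: "(\<integral>\<^sup>+x. potential R \<rho> x * indicator A x \<partial>\<rho>) \<le> ennreal V"
    unfolding V(1)[symmetric] by (intro nn_integral_mono) (auto simp: indicator_def)
  then have a: "(\<integral>\<^sup>+x. potential R \<rho> x * indicator A x \<partial>\<rho>) = ennreal a" "a \<ge> 0"
    unfolding a_def by (auto intro!: ennreal_enn2real[symmetric] simp: less_top[symmetric] top_unique)
  have "(\<integral>\<^sup>+x. potential R \<rho> x * indicator A x \<partial>\<rho>) < (\<integral>\<^sup>+x. ennreal V * indicator A x \<partial>\<rho>)"
  proof (rule nn_integral_less)
    show "AE x in \<rho>. potential R \<rho> x * indicator A x \<le> ennreal V * indicator A x"
      by (auto simp: A_def indicator_def)
    show "\<not> (AE x in \<rho>. ennreal V * indicator A x \<le> potential R \<rho> x * indicator A x)"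
      using nA by (auto elim!: contrapos_nn eventually_mono simp: A_def indicator_def split: if_splits)
  qed (use a in auto)
  then have aV: "a < al * V"
    using a V(2) by (simp add: nn_integral_cmult_indicator emeasure_eq_measure al_def
        ennreal_mult[symmetric] ennreal_less_iff mult.commute)
  define pA where "pA x = (\<integral>\<^sup>+y. log_kernel R x y * indicator A y \<partial>\<rho>)" for x
  have [measurable]: "pA \<in> borel_measurable borel" unfolding pA_def by measurable
  have pA_le: "pA x \<le> potential R \<rho> x" for x
    unfolding pA_def potential_def by (intro nn_integral_mono) (auto simp: indicator_def)
  have int_pA: "(\<integral>\<^sup>+x. pA x \<partial>\<rho>) = ennreal a"
  proof -
    interpret pair_sigma_finite \<rho> \<rho> ..
    have "(\<integral>\<^sup>+x. pA x \<partial>\<rho>) = (\<integral>\<^sup>+y. \<integral>\<^sup>+x. log_kernel R x y * indicator A y \<partial>\<rho> \<partial>\<rho>)"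
      unfolding pA_def by (rule Fubini'[symmetric]) measurable
    also have "\<dots> = (\<integral>\<^sup>+y. potential R \<rho> y * indicator A y \<partial>\<rho>)"
      unfolding potential_def
      by (intro nn_integral_cong) (simp add: nn_integral_multc log_kernel_commute)
    finally show ?thesis using a by simp
  qed
  define c where "c = enn2real (\<integral>\<^sup>+x. pA x * indicator A x \<partial>\<rho>)"
  have "(\<integral>\<^sup>+x. pA x * indicator A x \<partial>\<rho>) \<le> (\<integral>\<^sup>+x. potential R \<rho> x * indicator A x \<partial>\<rho>)"
    by (intro nn_integral_mono mult_right_mono pA_le) auto
  then have c_le: "(\<integral>\<^sup>+x. pA x * indicator A x \<partial>\<rho>) \<le> ennreal a" using a by simp
  then have c: "(\<integral>\<^sup>+x. pA x * indicator A x \<partial>\<rho>) = ennreal c" "c \<ge> 0"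
    unfolding c_def by (auto intro!: ennreal_enn2real[symmetric] simp: less_top[symmetric] top_unique)
  have ca: "c \<le> a" using c_le c a by (simp add: ennreal_le_iff)
  \<comment> \<open>The competitor is \<open>1 - s * al\<close> times \<rho> plus \<open>s\<close>
    times the restriction of \<rho> to \<open>A\<close>, of total mass 1. Its energy is quadratic in
    \<open>s\<close> and, by minimality, at least \<open>V\<close>.\<close>
  have key: "V \<le> (1 - s * al)\<^sup>2 * V + 2 * (1 - s * al) * s * a + s\<^sup>2 * c" if s: "0 \<le> s" "s \<le> 1" for s
  proof -
    define p where "p = 1 - s * al"
    have p: "p \<ge> 0" unfolding p_def using s al by (simp add: mult_le_one)
    define w where "w x = ennreal p + ennreal s * indicator A x" for x
    have [measurable]: "w \<in> borel_measurable borel" unfolding w_def by measurable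
    define \<sigma> where "\<sigma> = density \<rho> w"
    have [measurable_cong]: "sets \<sigma> = sets borel" by (simp add: \<sigma>_def \<open>sets \<rho> = sets borel\<close>)
    have "(\<integral>\<^sup>+x. w x \<partial>\<rho>) = ennreal p + ennreal s * ennreal al"
      unfolding w_def by (simp add: nn_integral_add nn_integral_cmult_indicator emeasure_eq_measure prob_space al_def)
    also have "\<dots> = ennreal (p + s * al)" using p s al by (simp add: ennreal_mult)
    finally have w1: "(\<integral>\<^sup>+x. w x \<partial>\<rho>) = 1" by (simp add: p_def)
    have "emeasure \<sigma> E = (\<integral>\<^sup>+x. w x * indicator E x \<partial>\<rho>)"
      unfolding \<sigma>_def by (intro emeasure_density) (simp_all add: E \<open>sets \<rho> = sets borel\<close>)
    also have "\<dots> = (\<integral>\<^sup>+x. w x \<partial>\<rho>)"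
      by (rule nn_integral_cong_AE, use AE_E in eventually_elim) simp
    finally have "emeasure \<sigma> E = (\<integral>\<^sup>+x. w x \<partial>\<rho>)" .
    moreover have "prob_space \<sigma>"
      by (rule prob_spaceI) (simp add: \<sigma>_def emeasure_density w1 cong: nn_integral_cong)
    ultimately have "\<sigma> \<in> prob_measures_on E"
      using w1 by (simp add: prob_measures_on_def \<open>sets \<sigma> = sets borel\<close>)
    then have "ennreal V \<le> (\<integral>\<^sup>+x. potential R \<sigma> x \<partial>\<sigma>)" by (rule min)
    also have "\<dots> = (\<integral>\<^sup>+x. w x * (ennreal p * potential R \<rho> x + ennreal s * pA x) \<partial>\<rho>)"
    proof -
      have "potential R \<sigma> x = ennreal p * potential R \<rho> x + ennreal s * pA x" for x
      proof -
        have "potential R \<sigma> x = (\<integral>\<^sup>+y. ennreal p * log_kernel R x y + ennreal s * (log_kernel R x y * indicator A y) \<partial>\<rho>)"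
          unfolding potential_def \<sigma>_def
          by (subst nn_integral_density) (auto simp: w_def algebra_simps intro!: nn_integral_cong)
        then show ?thesis by (simp add: nn_integral_add nn_integral_cmult potential_def pA_def)
      qed
      then have "(\<integral>\<^sup>+x. potential R \<sigma> x \<partial>\<sigma>) =
          (\<integral>\<^sup>+x. ennreal p * potential R \<rho> x + ennreal s * pA x \<partial>\<sigma>)" by simp
      then show ?thesis unfolding \<sigma>_def by (subst (asm) (2) nn_integral_density) auto
    qed
    also have "\<dots> = (\<integral>\<^sup>+x. ennreal (p * p) * potential R \<rho> x + ennreal (p * s) * pA x +
       (ennreal (s * p) * (potential R \<rho> x * indicator A x) + ennreal (s * s) * (pA x * indicator A x)) \<partial>\<rho>)"
      using p s by (intro nn_integral_cong) (simp add: w_def ennreal_mult algebra_simps)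
    also have "\<dots> = ennreal (p * p) * ennreal V + ennreal (p * s) * ennreal a +
        (ennreal (s * p) * ennreal a + ennreal (s * s) * ennreal c)"
      by (simp add: nn_integral_add nn_integral_cmult V a c int_pA)
    also have "\<dots> = ennreal (p * p * V + p * s * a + (s * p * a + s * s * c))"
      using p s(1) V(2) a(2) c(2)
      by (simp only: ennreal_plus ennreal_mult mult_nonneg_nonneg add_nonneg_nonneg)
    finally have "V \<le> p * p * V + p * s * a + (s * p * a + s * s * c)"
      using p s V(2) a(2) c(2) by (subst (asm) ennreal_le_iff) auto
    then show ?thesis by (simp add: p_def power2_eq_square algebra_simps)
  qed
  have Vpos: "V > 0" using aV a(2) al V(2) by (metis less_eq_real_def mult_zero_right not_less)
  \<comment> \<open>The derivative of the energy at \<open>s = 0\<close> is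
    \<open>2 * (a - al * V)\<close>, which is negative. The quadratic coefficient is at most
    \<open>2 * V\<close>, so this \<open>s\<close> makes the second-order term too small to
    compensate; the cap 1 keeps \<open>s\<close> admissible.\<close>
  define s where "s = min 1 ((al * V - a) / (2 * V))"
  have s: "0 < s" "s \<le> 1" using aV Vpos by (auto simp: s_def)
  have sV: "s * (2 * V) \<le> al * V - a"
    using Vpos by (simp add: s_def min_def field_simps)
  have "V \<le> (1 - s * al)\<^sup>2 * V + 2 * (1 - s * al) * s * a + s\<^sup>2 * c" by (rule key) (use s in auto)
  then have "s * (2 * (al * V - a)) \<le> s * (s * (al\<^sup>2 * V - 2 * al * a + c))"
    by (simp add: power2_eq_square algebra_simps)
  then have "2 * (al * V - a) \<le> s * (al\<^sup>2 * V - 2 * al * a + c)" using s by simp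
  also have "\<dots> \<le> s * (2 * V)"
  proof -
    have "al\<^sup>2 * V \<le> 1 * V" using al V(2) by (intro mult_right_mono) (auto simp: power_le_one)
    moreover have "al * V \<le> 1 * V" using al V(2) by (intro mult_right_mono) auto
    moreover have "0 \<le> 2 * al * a" using al a by simp
    ultimately have "al\<^sup>2 * V - 2 * al * a + c \<le> 2 * V" using aV ca by linarith
    then show ?thesis using s by (intro mult_left_mono) auto
  qed
  finally show False using sV aV by simp
qed

section \<open>The lower envelope theorem\<close>

text \<open>\<open>b - min b c\<close> is the positive part of \<open>b - c\<close>, hence monotone
  in \<open>b\<close>, and the kernel decreases with the distance.\<close>

lemma log_kernel_tail_mono_dist:
  assumes "R > 0" "\<bar>x' - y\<bar> \<le> \<bar>x - y\<bar>"
  shows "log_kernel R x y - min (log_kernel R x y) (of_nat m) \<le>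
    log_kernel R x' y - min (log_kernel R x' y) (of_nat m)"
proof -
  have "b - min b c \<le> a - min a c" if "b \<le> a" "c \<noteq> \<top>" for a b c :: ennreal
    using that by (cases a; cases b; cases c)
      (auto simp: min_def ennreal_minus top_unique intro!: ennreal_leI)
  then show ?thesis using log_kernel_mono_dist[OF assms] by simp
qed

text \<open>Each of the nearest points of \<open>K\<close> to the left and to the right of \<open>x\<close> is at least as close
  as \<open>x\<close> to the part of \<open>K\<close> on its side.\<close>

lemma log_kernel_tail_extend:
  assumes R: "R > 0" and [measurable_cong]: "sets \<sigma> = sets borel"
    and K: "closed K" "AE y in \<sigma>. y \<in> K"
    and le: "\<And>x. x \<in> K \<Longrightarrow> (\<integral>\<^sup>+y. log_kernel R x y - min (log_kernel R x y) (of_nat m) \<partial>\<sigma>) \<le> c"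
  shows "(\<integral>\<^sup>+y. log_kernel R x y - min (log_kernel R x y) (of_nat m) \<partial>\<sigma>) \<le> c + c"
proof -
  let ?h = "\<lambda>x y. log_kernel R x y - min (log_kernel R x y) (of_nat m)"
  obtain g1 where [measurable]: "g1 \<in> borel_measurable borel" and g1: "(\<integral>\<^sup>+y. g1 y \<partial>\<sigma>) \<le> c"
    "\<And>y. y \<in> K \<Longrightarrow> y \<le> x \<Longrightarrow> ?h x y \<le> g1 y"
  proof (cases "K \<inter> {..x} = {}")
    case True
    then show thesis by (intro that[of "\<lambda>_. 0"]) auto
  next
    case False
    have bdd: "bdd_above (K \<inter> {..x})" by (rule bdd_aboveI[of _ x]) simp
    define a where "a = Sup (K \<inter> {..x})"
    have "a \<in> K \<inter> {..x}"
      unfolding a_def using False bdd K(1) by (intro closed_contains_Sup closed_Int closed_atMost)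
    moreover have "y \<le> a" if "y \<in> K" "y \<le> x" for y
      unfolding a_def using that bdd by (intro cSup_upper) auto
    ultimately have a: "a \<in> K" "a \<le> x" "\<And>y. y \<in> K \<Longrightarrow> y \<le> x \<Longrightarrow> y \<le> a" by auto
    show thesis
      by (rule that[of "?h a"])
        (use a(2,3) le[OF a(1)] in \<open>auto intro!: log_kernel_tail_mono_dist[OF R]\<close>)
  qed
  obtain g2 where [measurable]: "g2 \<in> borel_measurable borel" and g2: "(\<integral>\<^sup>+y. g2 y \<partial>\<sigma>) \<le> c"
    "\<And>y. y \<in> K \<Longrightarrow> x \<le> y \<Longrightarrow> ?h x y \<le> g2 y"
  proof (cases "K \<inter> {x..} = {}")
    case True
    then show thesis by (intro that[of "\<lambda>_. 0"]) auto
  next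
    case False
    have bdd: "bdd_below (K \<inter> {x..})" by (rule bdd_belowI[of _ x]) simp
    define b where "b = Inf (K \<inter> {x..})"
    have "b \<in> K \<inter> {x..}"
      unfolding b_def using False bdd K(1) by (intro closed_contains_Inf closed_Int closed_atLeast)
    moreover have "b \<le> y" if "y \<in> K" "x \<le> y" for y
      unfolding b_def using that bdd by (intro cInf_lower) auto
    ultimately have b: "b \<in> K" "x \<le> b" "\<And>y. y \<in> K \<Longrightarrow> x \<le> y \<Longrightarrow> b \<le> y" by auto
    show thesis
      by (rule that[of "?h b"])
        (use b(2,3) le[OF b(1)] in \<open>auto intro!: log_kernel_tail_mono_dist[OF R]\<close>)
  qed
  have "(\<integral>\<^sup>+y. ?h x y \<partial>\<sigma>) \<le> (\<integral>\<^sup>+y. g1 y + g2 y \<partial>\<sigma>)"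
  proof (rule nn_integral_mono_AE, use K(2) in eventually_elim)
    fix y assume "y \<in> K"
    then show "?h x y \<le> g1 y + g2 y"
      using g1(2)[of y] g2(2)[of y]
      by (cases "y \<le> x") (auto intro: order_trans add_increasing add_increasing2)
  qed
  also have "\<dots> = (\<integral>\<^sup>+y. g1 y \<partial>\<sigma>) + (\<integral>\<^sup>+y. g2 y \<partial>\<sigma>)" by (rule nn_integral_add) measurable
  also have "\<dots> \<le> c + c" using g1(1) g2(1) by (rule add_mono)
  finally show ?thesis .
qed

text \<open>Finite energy makes the potential finite at almost every \<open>x\<close>, and there the
  kernel is an integrable majorant of all tails. The tail at \<open>y\<close> vanishes once
  \<open>m\<close> exceeds the finite kernel value, so dominated convergence applies.\<close>

lemma AE_log_kernel_tail_tendsto_0: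
  assumes rho: "prob_space \<rho>" "sets \<rho> = sets borel"
    and fin: "(\<integral>\<^sup>+x. potential R \<rho> x \<partial>\<rho>) < \<infinity>"
  shows "AE x in \<rho>. (\<lambda>m. \<integral>\<^sup>+y. log_kernel R x y - min (log_kernel R x y) (of_nat m) \<partial>\<rho>) \<longlonglongrightarrow> 0"
proof -
  interpret prob_space \<rho> by fact
  note [measurable_cong] = rho(2)
  have sf: "sigma_finite_measure \<rho>" by (rule sigma_finite_measure_axioms)
  note [measurable] = measurable_potential[OF sf rho(2)]
  let ?h = "\<lambda>m x y. log_kernel R x y - min (log_kernel R x y) (of_nat m)"
  have "AE x in \<rho>. potential R \<rho> x \<noteq> \<infinity>"
    using fin by (intro nn_integral_PInf_AE) auto
  then show ?thesis
  proof eventually_elim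
    fix x assume x: "potential R \<rho> x \<noteq> \<infinity>"
    have "AE y in \<rho>. log_kernel R x y \<noteq> \<infinity>"
      using x unfolding potential_def by (intro nn_integral_PInf_AE) auto
    then have "AE y in \<rho>. (\<lambda>m. ?h m x y) \<longlonglongrightarrow> 0"
    proof eventually_elim
      fix y assume "log_kernel R x y \<noteq> \<infinity>"
      then obtain N :: nat where N: "log_kernel R x y \<le> of_nat N"
        by (metis ennreal_Ex_less_of_nat infinity_ennreal_def less_imp_le less_top)
      show "(\<lambda>m. ?h m x y) \<longlonglongrightarrow> 0"
      proof (rule tendsto_eventually, rule eventually_sequentiallyI)
        fix m assume "N \<le> m"
        then have "log_kernel R x y \<le> of_nat m" using N by (meson of_nat_mono order_trans)
        then show "?h m x y = 0" using \<open>log_kernel R x y \<noteq> \<infinity>\<close> by (simp add: min_absorb1)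
      qed
    qed
    then have "(\<lambda>m. \<integral>\<^sup>+y. ?h m x y \<partial>\<rho>) \<longlonglongrightarrow> (\<integral>\<^sup>+y. 0 \<partial>\<rho>)"
      using x unfolding potential_def
      by (intro nn_integral_dominated_convergence[where w="log_kernel R x"])
        (auto simp: less_top[symmetric] diff_le_self_ennreal)
    then show "(\<lambda>m. \<integral>\<^sup>+y. ?h m x y \<partial>\<rho>) \<longlonglongrightarrow> 0" by simp
  qed
qed

lemma tendsto_nn_integral_weak_conv:
  fixes u :: "real \<Rightarrow> ennreal"
  assumes "\<And>n. real_distribution (\<nu>s n)" "real_distribution \<nu>" "weak_conv_m \<nu>s \<nu>"
    and u: "continuous_on UNIV u" "\<And>x. u x \<le> of_nat m"
  shows "(\<lambda>n. \<integral>\<^sup>+x. u x \<partial>\<nu>s n) \<longlonglongrightarrow> (\<integral>\<^sup>+x. u x \<partial>\<nu>)"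
proof -
  define v where "v x = enn2real (u x)" for x
  have fin: "u x < \<top>" for x using u(2)[of x] by (meson le_less_trans of_nat_less_top)
  have v: "u x = ennreal (v x)" "0 \<le> v x" "v x \<le> real m" for x
  proof -
    show 1: "u x = ennreal (v x)" using fin[of x] by (simp add: v_def)
    show 2: "0 \<le> v x" by (simp add: v_def)
    show "v x \<le> real m" using u(2)[of x] 2 unfolding 1
      by (simp add: ennreal_of_nat_eq_real_of_nat)
  qed
  have cont: "continuous_on UNIV v"
  proof (rule continuous_on_sequentiallyI)
    fix s :: "nat \<Rightarrow> real" and a assume "s \<longlonglongrightarrow> a"
    then have "(\<lambda>n. u (s n)) \<longlonglongrightarrow> u a"
      using continuous_on_tendsto_compose[OF u(1)] by simp
    then have "(\<lambda>n. u (s n)) \<longlonglongrightarrow> ennreal (v a)" using v(1)[of a] by simp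
    from tendsto_enn2real[OF this v(2)] show "(\<lambda>n. v (s n)) \<longlonglongrightarrow> v a" by (simp add: v_def)
  qed
  have int: "(\<integral>\<^sup>+x. u x \<partial>M) = ennreal (\<integral>x. v x \<partial>M)" if "real_distribution M" for M
  proof -
    interpret real_distribution M by fact
    have "integrable M v"
      by (rule integrable_const_bound[where B="real m"])
        (use v(2,3) borel_measurable_continuous_onI[OF cont] in auto)
    then show ?thesis unfolding v(1) using v(2) by (intro nn_integral_eq_integral) auto
  qed
  have "(\<lambda>n. \<integral>x. v x \<partial>\<nu>s n) \<longlonglongrightarrow> (\<integral>x. v x \<partial>\<nu>)"
    by (rule weak_conv_imp_integral_bdd_continuous_conv[where B="real m"])
      (use assms cont v in \<open>auto simp: continuous_on_eq_continuous_at\<close>)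
  then show ?thesis using assms(1,2) by (simp add: int)
qed

text \<open>The potentials of \<open>1\<^sub>G \<rho>\<close>, for sets \<open>G\<close> on which the tails of \<open>potential R \<rho>\<close> are uniformly
  small, are nearly continuous; they serve as test functions, and \<open>G\<close> exhausts \<open>\<rho>\<close>.\<close>

lemma AE_le_potential_of_liminf:
  assumes R: "R > 0" and rho: "prob_space \<rho>" "sets \<rho> = sets borel"
    and fin: "(\<integral>\<^sup>+x. potential R \<rho> x \<partial>\<rho>) < \<infinity>" and V: "V < \<infinity>"
    and nu: "\<And>n. real_distribution (\<nu>s n)" "real_distribution \<nu>" "weak_conv_m \<nu>s \<nu>"
    and liminf: "AE x in \<rho>. V \<le> liminf (\<lambda>n. potential R (\<nu>s n) x)"
  shows "AE x in \<rho>. V \<le> potential R \<nu> x"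
proof (rule ccontr)
  assume not: "\<not> ?thesis"
  interpret prob_space \<rho> by fact
  interpret nu: real_distribution \<nu> by fact
  interpret nus: real_distribution "\<nu>s n" for n by fact
  have sf: "sigma_finite_measure \<rho>" "sigma_finite_measure \<nu>" "sigma_finite_measure (\<nu>s n)" for n
    by (rule sigma_finite_measure_axioms nu.sigma_finite_measure_axioms nus.sigma_finite_measure_axioms)+
  note [measurable_cong] = rho(2)
  note [measurable] = measurable_potential[OF sf(1) rho(2)] measurable_potential[OF sf(2) nu.events_eq_borel]
    measurable_potential[OF sf(3) nus.events_eq_borel]
  let ?k = "\<lambda>m x y. min (log_kernel R x y) (of_nat m)"
  let ?h = "\<lambda>m x y. log_kernel R x y - ?k m x y"
  \<comment> \<open>\<open>B\<close> is where the claim fails. Since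
    \<open>potential R \<nu>\<close> is below \<open>V\<close> on \<open>B\<close> and
    \<open>B\<close> is not null, it suffices to show that its integral over \<open>B\<close> is at
    least \<open>V\<close> times the mass of \<open>B\<close>.\<close>
  define B where "B = {x. potential R \<nu> x < V}"
  have [measurable]: "B \<in> sets borel" unfolding B_def by measurable
  have nB: "\<not> (AE x in \<rho>. x \<notin> B)" using not by (simp add: B_def not_less)
  have step: "V * emeasure \<rho> (G \<inter> B) \<le> (\<integral>\<^sup>+x. potential R \<nu> x * indicator B x \<partial>\<rho>) + (e + e)"
    if G: "closed G" "\<And>x. x \<in> G \<Longrightarrow> (\<integral>\<^sup>+y. ?h m x y \<partial>\<rho>) \<le> e" for G m e
  proof -
    have [measurable]: "G \<in> sets borel" using G(1) by simp
    define \<sigma> where "\<sigma> = density \<rho> (indicator (G \<inter> B))"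
    have s_sets [measurable_cong]: "sets \<sigma> = sets borel" by (simp add: \<sigma>_def rho)
    have s_int: "(\<integral>\<^sup>+x. f x \<partial>\<sigma>) = (\<integral>\<^sup>+x. f x * indicator (G \<inter> B) x \<partial>\<rho>)"
      if [measurable]: "f \<in> borel_measurable borel" for f
      unfolding \<sigma>_def by (subst nn_integral_density) (auto simp: mult.commute)
    have s_em: "emeasure \<sigma> (space \<sigma>) = emeasure \<rho> (G \<inter> B)"
      using s_int[of "\<lambda>_. 1"] by simp
    then have s_fin: "finite_measure \<sigma>"
      by (intro finite_measureI) (simp add: emeasure_finite)
    then interpret s: finite_measure \<sigma> .
    have s_sf: "sigma_finite_measure \<sigma>" by (rule s.sigma_finite_measure_axioms)
    note [measurable] = measurable_potential[OF s_sf s_sets]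
    have s_le: "emeasure \<sigma> (space \<sigma>) \<le> 1"
      unfolding s_em by (rule emeasure_le_1)
    \<comment> \<open>The bound \<open>e\<close> is known only on \<open>G\<close>, whereas the
      measures \<open>\<nu>s n\<close> may charge points off \<open>G\<close>. Extending it to the
      whole line costs a factor 2.\<close>
    have tail: "(\<integral>\<^sup>+y. ?h m x y \<partial>\<sigma>) \<le> e + e" for x
    proof (rule log_kernel_tail_extend[OF R s_sets G(1)])
      show "AE y in \<sigma>. y \<in> G" unfolding \<sigma>_def by (subst AE_density) (auto simp: indicator_def)
      fix x assume "x \<in> G"
      have "(\<integral>\<^sup>+y. ?h m x y \<partial>\<sigma>) \<le> (\<integral>\<^sup>+y. ?h m x y \<partial>\<rho>)"
        by (subst s_int) (auto intro!: nn_integral_mono simp: indicator_def)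
      then show "(\<integral>\<^sup>+y. ?h m x y \<partial>\<sigma>) \<le> e" using G(2)[OF \<open>x \<in> G\<close>] by (rule order_trans)
    qed
    \<comment> \<open>\<open>u\<close> is the test function: truncation makes it continuous and
      bounded, and \<open>potential R \<sigma>\<close> exceeds it by at most
      \<open>e + e\<close>.\<close>
    define u where "u x = (\<integral>\<^sup>+y. ?k m x y \<partial>\<sigma>)" for x
    have u_cont: "continuous_on UNIV u" unfolding u_def
      by (rule continuous_nn_integral_ennreal[OF s_fin, where m=m])
        (simp_all add: continuous_on_min_log_kernel[OF R])
    then have [measurable]: "u \<in> borel_measurable borel" by (rule borel_measurable_continuous_onI)
    have u_le: "u x \<le> of_nat m" for x
    proof -
      have "u x \<le> (\<integral>\<^sup>+y. of_nat m \<partial>\<sigma>)" unfolding u_def by (intro nn_integral_mono) simp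
      also have "\<dots> = of_nat m * emeasure \<sigma> (space \<sigma>)" by simp
      also have "\<dots> \<le> of_nat m * 1" using s_le by (intro mult_left_mono) auto
      finally show ?thesis by simp
    qed
    have pot: "potential R \<sigma> x \<le> u x + (e + e)" for x
    proof -
      have "potential R \<sigma> x = (\<integral>\<^sup>+y. ?k m x y + ?h m x y \<partial>\<sigma>)"
        unfolding potential_def by (intro nn_integral_cong) (simp add: add_diff_inverse_ennreal)
      also have "\<dots> = u x + (\<integral>\<^sup>+y. ?h m x y \<partial>\<sigma>)" unfolding u_def by (rule nn_integral_add) measurable
      finally show ?thesis using tail[of x] by (simp add: add_left_mono)
    qed
    have "V * emeasure \<rho> (G \<inter> B) = (\<integral>\<^sup>+x. V \<partial>\<sigma>)"
      by (subst s_int) (auto simp: nn_integral_cmult_indicator)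
    also have "\<dots> \<le> (\<integral>\<^sup>+x. liminf (\<lambda>n. potential R (\<nu>s n) x) \<partial>\<sigma>)"
    proof (rule nn_integral_mono_AE)
      show "AE x in \<sigma>. V \<le> liminf (\<lambda>n. potential R (\<nu>s n) x)"
        unfolding \<sigma>_def by (subst AE_density) (use liminf in \<open>auto elim!: eventually_mono\<close>)
    qed
    \<comment> \<open>After Fatou's lemma, the symmetry of the kernel makes \<open>\<nu>s n\<close>
      the integrating measure, so that weak convergence can be applied to \<open>u\<close>.\<close>
    also have "\<dots> \<le> liminf (\<lambda>n. \<integral>\<^sup>+x. potential R (\<nu>s n) x \<partial>\<sigma>)"
      by (rule nn_integral_liminf) measurable
    also have "\<dots> = liminf (\<lambda>n. \<integral>\<^sup>+x. potential R \<sigma> x \<partial>\<nu>s n)"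
      using potential_commute[OF sf(3) nus.events_eq_borel s_sf s_sets] by simp
    also have "\<dots> \<le> liminf (\<lambda>n. (\<integral>\<^sup>+x. u x \<partial>\<nu>s n) + (e + e))"
    proof (intro Liminf_mono always_eventually allI)
      fix n
      have "(\<integral>\<^sup>+x. potential R \<sigma> x \<partial>\<nu>s n) \<le> (\<integral>\<^sup>+x. u x + (e + e) \<partial>\<nu>s n)"
        by (intro nn_integral_mono pot)
      also have "\<dots> = (\<integral>\<^sup>+x. u x \<partial>\<nu>s n) + (e + e)"
        using nus.emeasure_space_1[of n] by (simp add: nn_integral_add)
      finally show "(\<integral>\<^sup>+x. potential R \<sigma> x \<partial>\<nu>s n) \<le> (\<integral>\<^sup>+x. u x \<partial>\<nu>s n) + (e + e)" .
    qed
    also have "\<dots> = (\<integral>\<^sup>+x. u x \<partial>\<nu>) + (e + e)"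
      by (intro lim_imp_Liminf tendsto_add tendsto_const trivial_limit_sequentially
          tendsto_nn_integral_weak_conv[OF nu u_cont u_le])
    also have "(\<integral>\<^sup>+x. u x \<partial>\<nu>) \<le> (\<integral>\<^sup>+x. potential R \<sigma> x \<partial>\<nu>)"
      unfolding u_def potential_def by (intro nn_integral_mono) simp
    also have "\<dots> = (\<integral>\<^sup>+x. potential R \<nu> x \<partial>\<sigma>)"
      by (rule potential_commute[OF s_sf s_sets sf(2) nu.events_eq_borel])
    also have "\<dots> \<le> (\<integral>\<^sup>+x. potential R \<nu> x * indicator B x \<partial>\<rho>)"
      by (subst s_int) (auto intro!: nn_integral_mono simp: indicator_def)
    finally show ?thesis by (simp add: add_right_mono)
  qed
  have lim_le: "V * emeasure \<rho> B \<le> (\<integral>\<^sup>+x. potential R \<nu> x * indicator B x \<partial>\<rho>) + (e + e)" if "e > 0" for e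
  proof -
    \<comment> \<open>The sets increase with \<open>m\<close> and cover \<rho>-almost every point
      because the tails tend to 0. Continuity from below then replaces \<open>G m \<inter> B\<close>
      by \<open>B\<close>.\<close>
    define G where "G m = {x. (\<integral>\<^sup>+y. ?h m x y \<partial>\<rho>) \<le> e}" for m
    have closed_G: "closed (G m)" for m
      unfolding G_def by (rule closed_log_kernel_tail_le[OF R finite_measure_axioms rho(2)])
    then have [measurable]: "G m \<in> sets borel" for m by simp
    have incG: "G m \<subseteq> G m'" if "m \<le> m'" for m m'
    proof
      fix x assume "x \<in> G m"
      then have "(\<integral>\<^sup>+y. ?h m x y \<partial>\<rho>) \<le> e" by (simp add: G_def)
      moreover have "(\<integral>\<^sup>+y. ?h m' x y \<partial>\<rho>) \<le> (\<integral>\<^sup>+y. ?h m x y \<partial>\<rho>)"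
        using that by (intro nn_integral_mono ennreal_minus_mono min.mono order_refl) simp
      ultimately show "x \<in> G m'" unfolding G_def by (auto intro: order_trans)
    qed
    have "AE x in \<rho>. x \<in> (\<Union>m. G m)"
      using AE_log_kernel_tail_tendsto_0[OF rho fin]
    proof eventually_elim
      fix x assume "(\<lambda>m. \<integral>\<^sup>+y. ?h m x y \<partial>\<rho>) \<longlonglongrightarrow> 0"
      then have "eventually (\<lambda>m. (\<integral>\<^sup>+y. ?h m x y \<partial>\<rho>) < e) sequentially"
        using that by (rule order_tendstoD)
      then show "x \<in> (\<Union>m. G m)"
        unfolding G_def by (auto simp: eventually_sequentially intro: less_imp_le)
    qed
    then have "emeasure \<rho> B = emeasure \<rho> (\<Union>m. G m \<inter> B)"
      by (intro emeasure_eq_AE) (auto elim!: eventually_mono)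
    also have "\<dots> = (SUP m. emeasure \<rho> (G m \<inter> B))"
      using incG by (intro SUP_emeasure_incseq[symmetric]) (auto simp: incseq_def dest: subsetD)
    finally have "V * emeasure \<rho> B = (SUP m. V * emeasure \<rho> (G m \<inter> B))"
      by (simp add: SUP_mult_left_ennreal)
    also have "\<dots> \<le> (\<integral>\<^sup>+x. potential R \<nu> x * indicator B x \<partial>\<rho>) + (e + e)"
      by (intro SUP_least step[OF closed_G]) (simp add: G_def)
    finally show ?thesis .
  qed
  have "V * emeasure \<rho> B \<le> (\<integral>\<^sup>+x. potential R \<nu> x * indicator B x \<partial>\<rho>)"
  proof (rule ennreal_le_epsilon)
    fix e :: real assume "0 < e"
    then show "V * emeasure \<rho> B \<le> (\<integral>\<^sup>+x. potential R \<nu> x * indicator B x \<partial>\<rho>) + ennreal e"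
      using lim_le[of "ennreal (e / 2)"] by (simp add: ennreal_plus[symmetric] del: ennreal_plus)
  qed
  moreover have "(\<integral>\<^sup>+x. potential R \<nu> x * indicator B x \<partial>\<rho>) < (\<integral>\<^sup>+x. V * indicator B x \<partial>\<rho>)"
  proof (rule nn_integral_less)
    have "(\<integral>\<^sup>+x. potential R \<nu> x * indicator B x \<partial>\<rho>) \<le> (\<integral>\<^sup>+x. V \<partial>\<rho>)"
      by (intro nn_integral_mono) (auto simp: B_def indicator_def)
    then show "(\<integral>\<^sup>+x. potential R \<nu> x * indicator B x \<partial>\<rho>) \<noteq> \<infinity>"
      using V by (auto simp: emeasure_space_1 top_unique)
    show "AE x in \<rho>. potential R \<nu> x * indicator B x \<le> V * indicator B x"
      by (auto simp: B_def indicator_def)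
    show "\<not> (AE x in \<rho>. V * indicator B x \<le> potential R \<nu> x * indicator B x)"
      using nB by (auto elim!: contrapos_nn eventually_mono simp: B_def indicator_def split: if_splits)
  qed measurable
  ultimately show False by (simp add: nn_integral_cmult_indicator)
qed

section \<open>Zeros of orthogonal polynomials\<close>

lemma of_real_poly_map_poly:
  fixes p :: "real poly"
  shows "complex_of_real (poly p x) = poly (map_poly complex_of_real p) (complex_of_real x)"
  by (induction p) (auto simp: map_poly_pCons)

lemma poly_of_real_Re_Im:
  fixes q :: "complex poly"
  shows "poly q (complex_of_real x) = Complex (poly (map_poly Re q) x) (poly (map_poly Im q) x)"
  by (induction q) (simp_all add: map_poly_pCons complex_eq_iff)

lemma integrable_poly:
  assumes "finite_measure M" and [measurable_cong]: "sets M = sets borel" and "AE x in M. x \<in> {-r..r}"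
  shows "integrable M (poly (p :: real poly))"
proof -
  interpret finite_measure M by fact
  have "compact (poly p ` {-r..r})"
    by (intro compact_continuous_image compact_Icc continuous_intros)
  then obtain B where B: "\<forall>y\<in>poly p ` {-r..r}. norm y \<le> B"
    using compact_imp_bounded bounded_iff by metis
  moreover have "poly p \<in> borel_measurable borel"
    by (intro borel_measurable_continuous_onI continuous_intros)
  then have "poly p \<in> borel_measurable M" by measurable
  moreover have "AE x in M. norm (poly p x) \<le> B" using assms(3) by eventually_elim (use B in auto)
  ultimately show ?thesis by (intro integrable_const_bound[where B=B])
qed

text \<open>A nonnegative function with integral 0 vanishes almost everywhere; the hypothesis
  \<open>inf\<close>, an algebraic form of infinite support, then applies.\<close>

lemma poly_eq_0_of_integral_eq_0:
  assumes "finite_measure M" and M: "sets M = sets borel" and r: "AE x in M. x \<in> {-r..r}"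
    and inf: "\<And>q :: real poly. (AE x in M. poly q x = 0) \<Longrightarrow> q = 0"
    and p: "AE x in M. 0 \<le> poly p x" "(\<integral>x. poly p x \<partial>M) = 0"
  shows "p = 0"
proof (rule inf)
  show "AE x in M. poly p x = 0"
    using integral_nonneg_eq_0_iff_AE[OF integrable_poly[OF assms(1) M r] p(1)] p(2) by simp
qed

text \<open>A zero \<open>z\<close> of \<open>P = (x - z) Q\<close> is the mean of \<open>x\<close> with weight \<open>|Q|\<^sup>2\<close>; below, \<open>A\<close> and \<open>B\<close> are the real
  and imaginary parts of \<open>Q\<close>.\<close>

lemma monic_OP_zeros_real:
  assumes M: "finite_measure M" "sets M = sets borel" and r: "AE x in M. x \<in> {-r..r}"
    and inf: "\<And>q :: real poly. (AE x in M. poly q x = 0) \<Longrightarrow> q = 0"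
    and P: "is_monic_OP M n P" and z: "poly (map_poly complex_of_real P) z = 0"
  shows "Im z = 0" "Re z \<in> {-r..r}"
proof -
  have P0: "P \<noteq> 0" and deg: "degree P = n"
    and orth: "\<And>q. degree q < n \<Longrightarrow> (\<integral>x. poly P x * poly q x \<partial>M) = 0"
    using P by (auto simp: is_monic_OP_def)
  obtain Q where Q: "map_poly complex_of_real P = [:-z, 1:] * Q"
    using z by (auto simp: poly_eq_0_iff_dvd)
  have Q0: "Q \<noteq> 0" using P0 Q by (auto simp: map_poly_eq_0_iff)
  have "degree (map_poly complex_of_real P) = n" using deg by (simp add: degree_map_poly)
  then have dQ: "degree Q < n" unfolding Q using Q0 by (subst (asm) degree_mult_eq) auto
  define A where "A = map_poly Re Q"
  define B where "B = map_poly Im Q"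
  have dAB: "degree A < n" "degree B < n"
    using dQ map_poly_degree_leq[of Re Q] map_poly_degree_leq[of Im Q] by (auto simp: A_def B_def)
  define W where "W = A * A + B * B"
  \<comment> \<open>These are the real and imaginary parts of \<open>P = (x - z) Q\<close> on the
    real line, where \<open>P\<close> is real.\<close>
  have eqs: "poly P x = (x - Re z) * poly A x + Im z * poly B x"
    "0 = (x - Re z) * poly B x - Im z * poly A x" for x
  proof -
    have "complex_of_real (poly P x) = (of_real x - z) * poly Q (of_real x)"
      using arg_cong[OF Q, of "\<lambda>p. poly p (of_real x)"]
      by (simp add: of_real_poly_map_poly[symmetric] algebra_simps)
    then show "poly P x = (x - Re z) * poly A x + Im z * poly B x"
      "0 = (x - Re z) * poly B x - Im z * poly A x"
      by (simp_all add: poly_of_real_Re_Im A_def B_def complex_eq_iff)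
  qed
  have W: "poly W x = (poly A x)\<^sup>2 + (poly B x)\<^sup>2" for x by (simp add: W_def power2_eq_square)
  have W0: "W \<noteq> 0"
  proof
    assume "W = 0"
    then have "poly A x = 0 \<and> poly B x = 0" for x using W[of x] by (simp add: sum_power2_eq_zero_iff)
    then have "A = 0" "B = 0" by (simp_all add: poly_all_0_iff_0[symmetric])
    moreover have "coeff A i = Re (coeff Q i)" "coeff B i = Im (coeff Q i)" for i
      by (simp_all add: A_def B_def coeff_map_poly)
    ultimately have "coeff Q i = 0" for i by (simp add: complex_eq_iff)
    then show False using Q0 by (simp add: poly_eq_iff)
  qed
  \<comment> \<open>Multiplying \<open>P\<close> by \<open>B\<close> and by \<open>A\<close>
    eliminates the cross terms and leaves \<open>|Q|^2\<close> with the factors \<open>Im z\<close>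
    and \<open>x - Re z\<close>. Both \<open>A\<close> and \<open>B\<close> have degree below
    \<open>n\<close>, so the two products have integral 0.\<close>
  have 1: "poly P x * poly B x = Im z * poly W x" for x
  proof -
    have "poly P x * poly B x - ((x - Re z) * poly B x - Im z * poly A x) * poly A x = Im z * poly W x"
      by (subst eqs(1)) (simp add: W power2_eq_square algebra_simps)
    then show ?thesis unfolding eqs(2)[symmetric] by simp
  qed
  have 2: "poly P x * poly A x = (x - Re z) * poly W x" for x
  proof -
    have "poly P x * poly A x + ((x - Re z) * poly B x - Im z * poly A x) * poly B x = (x - Re z) * poly W x"
      by (subst eqs(1)) (simp add: W power2_eq_square algebra_simps)
    then show ?thesis unfolding eqs(2)[symmetric] by simp
  qed
  have "Im z * (\<integral>x. poly W x \<partial>M) = 0" using orth[OF dAB(2)] by (simp add: 1)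
  moreover have "(\<integral>x. poly W x \<partial>M) \<noteq> 0"
    using poly_eq_0_of_integral_eq_0[OF M r inf, of W] W0 by (auto simp: W)
  ultimately show "Im z = 0" by simp
  have int: "(\<integral>x. (x - Re z) * poly W x \<partial>M) = 0" using orth[OF dAB(1)] by (simp add: 2)
  show "Re z \<in> {-r..r}"
  proof (rule ccontr)
    assume "Re z \<notin> {-r..r}"
    then consider "r < Re z" | "Re z < -r" by fastforce
    then have "[:- Re z, 1:] * W = 0"
    proof cases
      case 1
      \<comment> \<open>The sign is reversed here so that the integrand is nonnegative for
        \<open>x \<le> r < Re z\<close>.\<close>
      have "[:Re z, -1:] * W = 0"
      proof (rule poly_eq_0_of_integral_eq_0[OF M r inf])
        show "AE x in M. 0 \<le> poly ([:Re z, - 1:] * W) x"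
          using r
        proof eventually_elim
          fix x assume "x \<in> {-r..r}"
          then have "0 \<le> (Re z - x) * poly W x" using 1 by (intro mult_nonneg_nonneg) (auto simp: W)
          then show "0 \<le> poly ([:Re z, - 1:] * W) x" by (simp add: algebra_simps)
        qed
        have "(\<integral>x. poly ([:Re z, - 1:] * W) x \<partial>M) = (\<integral>x. - ((x - Re z) * poly W x) \<partial>M)"
          by (intro Bochner_Integration.integral_cong) (auto simp: algebra_simps)
        then show "(\<integral>x. poly ([:Re z, - 1:] * W) x \<partial>M) = 0" using int by simp
      qed
      then show ?thesis using W0 by (simp only: mult_eq_0_iff) simp
    next
      case 2
      show ?thesis
      proof (rule poly_eq_0_of_integral_eq_0[OF M r inf])
        show "AE x in M. 0 \<le> poly ([:- Re z, 1:] * W) x"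
          using r
        proof eventually_elim
          fix x assume "x \<in> {-r..r}"
          then have "0 \<le> (x - Re z) * poly W x" using 2 by (intro mult_nonneg_nonneg) (auto simp: W)
          then show "0 \<le> poly ([:- Re z, 1:] * W) x" by (simp add: algebra_simps)
        qed
        have "(\<integral>x. poly ([:- Re z, 1:] * W) x \<partial>M) = (\<integral>x. (x - Re z) * poly W x \<partial>M)"
          by (intro Bochner_Integration.integral_cong) (auto simp: algebra_simps)
        then show "(\<integral>x. poly ([:- Re z, 1:] * W) x \<partial>M) = 0" using int by simp
      qed
    qed
    then show False using W0 by (simp only: mult_eq_0_iff) simp
  qed
qed

section \<open>The zero counting measure as a finite atomic measure\<close>

lemma zero_counting_measure_eq_distr:
  assumes "degree P > 0"
  defines "p \<equiv> map_poly complex_of_real P"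
  shows "zero_counting_measure P =
    distr (point_measure {z. poly p z = 0} (\<lambda>z. of_nat (order z p) / of_nat (degree p))) borel id"
proof -
  have p0: "p \<noteq> 0" using assms(1) by (auto simp: p_def map_poly_eq_0_iff)
  then have fin: "finite {z. poly p z = 0}" by (rule poly_roots_finite)
  let ?D = "distr (point_measure {z. poly p z = 0} (\<lambda>z. of_nat (order z p) / of_nat (degree p))) borel id"
  have em: "emeasure ?D A = (\<Sum>z\<in>{z. poly p z = 0}. of_nat (order z p) * indicator A z) / of_nat (degree p)"
    if "A \<in> sets borel" for A
  proof -
    have "emeasure ?D A = (\<integral>\<^sup>+z. indicator A z \<partial>?D)" using that by simp
    also have "\<dots> = (\<Sum>z\<in>{z. poly p z = 0}. of_nat (order z p) / of_nat (degree p) * indicator A z)"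
      using that fin by (subst nn_integral_distr) (auto simp: nn_integral_point_measure_finite)
    finally show ?thesis
      by (simp add: divide_ennreal_def sum_distrib_left mult.assoc mult.commute mult.left_commute)
  qed
  \<comment> \<open>\<open>measure_of\<close> reproduces a set function only if it is countably
    additive; this follows from its agreement with the image of a point measure.\<close>
  have "zero_counting_measure P = measure_of UNIV (sets borel) (emeasure ?D)"
    unfolding zero_counting_measure_def Let_def p_def[symmetric]
    by (rule measure_of_eq) (auto simp: em sets.sigma_sets_eq[of borel, simplified])
  also have "\<dots> = ?D" using measure_of_of_measure[of ?D] by simp
  finally show ?thesis .
qed

lemma sum_order_eq_degree:
  fixes p :: "complex poly"
  assumes "p \<noteq> 0"
  shows "(\<Sum>z\<in>{z. poly p z = 0}. order z p) = degree p"
proof -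
  have "degree p = degree (smult (lead_coeff p) (\<Prod>z|poly p z = 0. [:-z, 1:] ^ order z p))"
    by (simp only: complex_poly_decompose)
  also have "\<dots> = (\<Sum>z\<in>{z. poly p z = 0}. order z p)"
    using assms by (simp add: degree_prod_sum_eq degree_power_eq)
  finally show ?thesis by simp
qed

lemma nn_integral_zero_counting_measure:
  assumes "degree P > 0" and [measurable]: "f \<in> borel_measurable borel"
  defines "p \<equiv> map_poly complex_of_real P"
  shows "(\<integral>\<^sup>+z. f z \<partial>zero_counting_measure P) =
    (\<Sum>z\<in>{z. poly p z = 0}. of_nat (order z p) / of_nat (degree p) * f z)"
proof -
  have p0: "p \<noteq> 0" using assms(1) by (auto simp: p_def map_poly_eq_0_iff)
  then have fin: "finite {z. poly p z = 0}" by (rule poly_roots_finite)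
  then show ?thesis
    unfolding zero_counting_measure_eq_distr[OF assms(1)] p_def[symmetric]
    by (subst nn_integral_distr) (auto simp: nn_integral_point_measure_finite)
qed

lemma sets_zero_counting_measure [measurable_cong, simp]:
  "sets (zero_counting_measure P) = sets borel"
  unfolding zero_counting_measure_def Let_def
  by (simp add: sets.sigma_sets_eq[of borel, simplified])

lemma prob_space_zero_counting_measure:
  assumes "degree P > 0"
  shows "prob_space (zero_counting_measure P)"
proof
  let ?p = "map_poly complex_of_real P"
  have p: "?p \<noteq> 0" "degree ?p > 0" using assms by (auto simp: map_poly_eq_0_iff degree_map_poly)
  have "emeasure (zero_counting_measure P) (space (zero_counting_measure P)) =
    (\<integral>\<^sup>+z. 1 \<partial>zero_counting_measure P)" by simp
  also have "\<dots> = (\<Sum>z\<in>{z. poly ?p z = 0}. of_nat (order z ?p) / of_nat (degree ?p))"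
    by (subst nn_integral_zero_counting_measure[OF assms]) auto
  also have "\<dots> = of_nat (\<Sum>z\<in>{z. poly ?p z = 0}. order z ?p) / of_nat (degree ?p)"
    by (simp add: divide_ennreal_def sum_distrib_right)
  also have "\<dots> = 1" using p unfolding sum_order_eq_degree[OF p(1)] by (intro ennreal_divide_self) (auto simp: of_nat_less_top)
  finally show "emeasure (zero_counting_measure P) (space (zero_counting_measure P)) = 1" .
qed

lemma AE_zero_counting_measure:
  assumes "degree P > 0" "\<And>z. poly (map_poly complex_of_real P) z = 0 \<Longrightarrow> Q z" "Measurable.pred borel Q"
  shows "AE z in zero_counting_measure P. Q z"
proof -
  note [measurable] = assms(3)
  have "(\<integral>\<^sup>+z. indicator {z. \<not> Q z} z \<partial>zero_counting_measure P) = 0"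
    by (subst nn_integral_zero_counting_measure[OF assms(1)]) (auto simp: indicator_def assms(2))
  then have "AE z in zero_counting_measure P. indicator {z. \<not> Q z} z = (0 :: ennreal)"
    by (subst (asm) nn_integral_0_iff_AE) auto
  then show ?thesis by eventually_elim (auto simp: indicator_def split: if_splits)
qed

text \<open>Since \<open>P\<close> is monic, \<open>|P x|\<close> is the product of the distances to
  the zeros, so the potential equals \<open>ln R - (1/n) ln |P x|\<close> when \<open>P x\<close> is
  not 0. The zeros are real and within \<open>R\<close> of \<open>x\<close>, so no kernel value is
  truncated.\<close>

lemma potential_zero_counting_measure_ge:
  assumes "R > 0" "T > 0" "degree P > 0" "lead_coeff P = 1"
    and real: "\<And>z. poly (map_poly complex_of_real P) z = 0 \<Longrightarrow> Im z = 0 \<and> \<bar>x - Re z\<bar> \<le> R"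
    and le: "\<bar>poly P x\<bar> \<le> T ^ degree P"
  shows "ennreal (ln (R / T)) \<le> potential R (distr (zero_counting_measure P) borel Re) x"
proof -
  define p where "p = map_poly complex_of_real P"
  define n where "n = degree P"
  have n: "n > 0" "degree p = n" using assms by (simp_all add: n_def p_def degree_map_poly)
  have p0: "p \<noteq> 0" using assms by (auto simp: p_def map_poly_eq_0_iff)
  then have fin: "finite {z. poly p z = 0}" by (rule poly_roots_finite)
  have pot: "potential R (distr (zero_counting_measure P) borel Re) x =
      (\<Sum>z\<in>{z. poly p z = 0}. of_nat (order z p) / of_nat n * log_kernel R x (Re z))"
    unfolding potential_def
    using nn_integral_zero_counting_measure[OF assms(3), of "\<lambda>z. log_kernel R x (Re z)"] n(2)
    by (subst nn_integral_distr) (auto simp: p_def)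
  show ?thesis
  proof (cases "poly P x = 0")
    \<comment> \<open>A zero at \<open>x\<close> contributes the infinite diagonal value with
      positive weight.\<close>
    case True
    then have x: "poly p (complex_of_real x) = 0" by (simp add: p_def of_real_poly_map_poly[symmetric])
    then have "order (complex_of_real x) p \<noteq> 0" using p0 by (simp add: order_root)
    then have "of_nat (order (complex_of_real x) p) / of_nat n * log_kernel R x (Re (complex_of_real x)) = (\<infinity>::ennreal)"
      by (simp add: log_kernel_def ennreal_mult_eq_top_iff divide_ennreal_def)
    moreover have "of_nat (order (complex_of_real x) p) / of_nat n * log_kernel R x (Re (complex_of_real x))
       \<le> (\<Sum>z\<in>{z. poly p z = 0}. of_nat (order z p) / of_nat n * log_kernel R x (Re z))"
      by (rule member_le_sum) (use x fin in auto)
    ultimately show ?thesis unfolding pot by (simp add: top_unique)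
  next
    case False
    define d where "d z = \<bar>x - Re z\<bar>" for z
    have nz: "x \<noteq> Re z" and dz: "0 < d z" "d z \<le> R" "cmod (complex_of_real x - z) = d z" if "poly p z = 0" for z
    proof -
      have z: "complex_of_real (Re z) = z" and d: "d z \<le> R"
        using real[of z] that by (auto simp: p_def complex_eq_iff d_def)
      show x: "x \<noteq> Re z"
      proof
        assume "x = Re z"
        then have "complex_of_real (poly P x) = 0" using that z by (simp add: p_def of_real_poly_map_poly)
        then show False using False by simp
      qed
      show "0 < d z" using x by (simp add: d_def)
      show "d z \<le> R" by (rule d)
      have "complex_of_real x - z = complex_of_real (x - Re z)" by (simp add: z)
      then show "cmod (complex_of_real x - z) = d z" by (simp only: norm_of_real d_def real_norm_def)
    qed
    have "lead_coeff p = 1" using assms(4) n by (simp add: p_def coeff_map_poly n_def)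
    moreover have "poly p (of_real x) =
        poly (smult (lead_coeff p) (\<Prod>z|poly p z = 0. [:-z, 1:] ^ order z p)) (of_real x)"
      by (simp only: complex_poly_decompose)
    ultimately have "poly p (of_real x) = (\<Prod>z|poly p z = 0. (of_real x - z) ^ order z p)"
      by (simp add: poly_prod poly_power)
    then have "\<bar>poly P x\<bar> = cmod (\<Prod>z|poly p z = 0. (of_real x - z) ^ order z p)"
      by (metis norm_of_real of_real_poly_map_poly p_def real_norm_def)
    also have "\<dots> = (\<Prod>z|poly p z = 0. d z ^ order z p)"
      by (simp add: prod_norm[symmetric] norm_power dz(3))
    finally have "ln \<bar>poly P x\<bar> = ln (\<Prod>z|poly p z = 0. d z ^ order z p)" by simp
    also have "\<dots> = (\<Sum>z|poly p z = 0. ln (d z ^ order z p))"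
    proof (rule ln_prod[OF fin])
      fix z assume "z \<in> {z. poly p z = 0}"
      then have "0 < d z" using dz(1) by simp
      then show "d z ^ order z p \<noteq> 0" by simp
    qed
    also have "\<dots> = (\<Sum>z|poly p z = 0. real (order z p) * ln (d z))"
      using dz(1) by (intro sum.cong) (auto simp: ln_realpow)
    finally have "ln \<bar>poly P x\<bar> = (\<Sum>z|poly p z = 0. real (order z p) * ln (d z))" .
    moreover have "ln \<bar>poly P x\<bar> \<le> real n * ln T"
    proof -
      have "ln \<bar>poly P x\<bar> \<le> ln (T ^ n)"
        using le False assms(2) unfolding n_def by (subst ln_le_cancel_iff) auto
      then show ?thesis using assms(2) by (simp add: ln_realpow)
    qed
    moreover have "(\<Sum>z|poly p z = 0. real (order z p)) = real n"
      using sum_order_eq_degree[OF p0] n(2) by (simp flip: of_nat_sum)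
    moreover have "(\<Sum>z|poly p z = 0. real (order z p) * ln (R / d z)) =
        (\<Sum>z|poly p z = 0. real (order z p)) * ln R - (\<Sum>z|poly p z = 0. real (order z p) * ln (d z))"
      unfolding sum_distrib_right sum_subtractf[symmetric]
    proof (rule sum.cong[OF refl])
      fix z assume "z \<in> {z. poly p z = 0}"
      then have "0 < d z" using dz(1) by simp
      then show "real (order z p) * ln (R / d z) = real (order z p) * ln R - real (order z p) * ln (d z)"
        using assms(1) by (simp add: ln_div algebra_simps)
    qed
    ultimately have "real n * ln (R / T) \<le> (\<Sum>z|poly p z = 0. real (order z p) * ln (R / d z))"
      using assms(1,2) by (simp add: ln_div algebra_simps)
    then have "ln (R / T) \<le> (\<Sum>z|poly p z = 0. real (order z p) * ln (R / d z)) / real n"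
      using n(1) by (simp add: field_simps)
    then have "ennreal (ln (R / T)) \<le> ennreal (\<Sum>z|poly p z = 0. real (order z p) / real n * ln (R / d z))"
      by (intro ennreal_leI) (simp add: sum_divide_distrib)
    also have "\<dots> = (\<Sum>z|poly p z = 0. ennreal (real (order z p) / real n * ln (R / d z)))"
      using dz n by (intro sum_ennreal[symmetric]) (auto intro!: mult_nonneg_nonneg)
    also have "\<dots> = potential R (distr (zero_counting_measure P) borel Re) x"
      unfolding pot
    proof (rule sum.cong[OF refl])
      fix z assume "z \<in> {z. poly p z = 0}"
      then have "0 \<le> ln (R / d z)" "x \<noteq> Re z" using dz nz by auto
      then show "ennreal (real (order z p) / real n * ln (R / d z)) =
          of_nat (order z p) / of_nat n * log_kernel R x (Re z)"
        using n(1) by (simp add: log_kernel_def d_def ennreal_of_nat_eq_real_of_nat divide_ennreal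
            ennreal_mult[symmetric])
    qed
    finally show ?thesis .
  qed
qed

section \<open>Limits of the zero counting measures\<close>

text \<open>The complement of the support is a union of null balls, and by Lindelof countably many
  of them cover it.\<close>

lemma AE_msupp:
  assumes [measurable_cong]: "sets M = sets borel"
  shows "AE x in M. x \<in> msupp M"
proof -
  define F where "F = {ball x e |x e. e > 0 \<and> emeasure M (ball x e) = 0}"
  obtain F' where F': "F' \<subseteq> F" "countable F'" "\<Union>F' = \<Union>F"
    using Lindelof[of F] by (auto simp: F_def)
  have "\<Union>F' \<in> null_sets M"
    using F'(1) by (intro null_sets_UN'[where N="\<lambda>X. X" and I=F', simplified] F'(2))
      (auto simp: F_def null_sets_def)
  then have "AE x in M. x \<notin> \<Union>F'" by (rule AE_not_in)
  then show ?thesis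
  proof eventually_elim
    fix x assume "x \<notin> \<Union>F'"
    then have "x \<notin> \<Union>F" using F'(3) by simp
    have "emeasure M (ball x e) \<noteq> 0" if "e > 0" for e
    proof
      assume "emeasure M (ball x e) = 0"
      then have "ball x e \<in> F" using that unfolding F_def by blast
      then show False using \<open>x \<notin> \<Union>F\<close> that by (auto dest: centre_in_ball[THEN iffD2])
    qed
    then show "x \<in> msupp M" by (simp add: msupp_def zero_less_iff_neq_zero)
  qed
qed

lemma msupp_subset_closed:
  assumes "sets M = sets borel" "closed F" "AE x in M. x \<in> F"
  shows "msupp M \<subseteq> F"
proof
  fix x assume x: "x \<in> msupp M"
  show "x \<in> F"
  proof (rule ccontr)
    assume "x \<notin> F"
    then obtain e where e: "e > 0" "ball x e \<inter> F = {}"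
      using assms(2) by (metis Compl_iff open_Compl open_contains_ball disjoint_eq_subset_Compl)
    have "AE y in M. y \<notin> ball x e" using assms(3) by eventually_elim (use e(2) in blast)
    then have "emeasure M (ball x e) = 0"
      by (rule emeasure_eq_0_of_AE_notin) (simp add: assms(1))
    then show False using x e(1) by (auto simp: msupp_def)
  qed
qed

text \<open>The zeros of a nonzero polynomial form a finite, hence closed, set, so its vanishing
  almost everywhere would make the support and \<open>E\<close> finite. Essential perfectness
  forbids this, finite sets having Lebesgue measure 0.\<close>

lemma poly_eq_0_of_AE_essentially_perfect:
  assumes M: "sets M = sets borel" and E: "E \<subseteq> msupp M" "essentially_perfect E" "E \<noteq> {}"
    and q: "AE x in M. poly q x = (0 :: real)"
  shows "q = 0"
proof (rule ccontr)
  assume "q \<noteq> 0"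
  then have fin: "finite {x. poly q x = 0}" by (rule poly_roots_finite)
  then have "msupp M \<subseteq> {x. poly q x = 0}"
    using q by (intro msupp_subset_closed M finite_imp_closed) auto
  then have "finite E" using E(1) fin by (meson finite_subset order_trans)
  then have "emeasure lborel (E \<inter> {x - 1<..<x + 1}) = 0" for x :: real
    by (intro emeasure_lborel_countable countable_finite) auto
  moreover obtain x where "x \<in> E" using E(3) by blast
  then have "emeasure lborel (E \<inter> {x - 1<..<x + 1}) > 0"
    using E(2) unfolding essentially_perfect_def by (metis zero_less_one)
  ultimately show False by simp
qed

text \<open>Fix \<open>S\<close> between \<open>C\<close> and \<open>T\<close>. Eventually the norm
  is at most \<open>S ^ m j\<close>, so Chebyshev bounds the mass where
  \<open>|Q j| \<ge> T ^ m j\<close> by \<open>(S/T) ^ (2 * m j)\<close>. As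
  \<open>j \<le> m j\<close>, these bounds are summable and Borel-Cantelli applies.\<close>

lemma AE_eventually_poly_le:
  assumes M: "finite_measure M" "sets M = sets borel" and r: "AE x in M. x \<in> {-r..r}"
    and m: "\<And>j. j \<le> m j" "\<And>j. m j > 0"
    and lim: "(\<lambda>j. L2_norm_poly M (Q j) powr (1 / real (m j))) \<longlonglongrightarrow> C" and C: "0 < C" "C < T"
  shows "AE x in M. eventually (\<lambda>j. \<bar>poly (Q j) x\<bar> \<le> T ^ m j) sequentially"
proof -
  interpret finite_measure M by fact
  note [measurable_cong] = M(2)
  obtain S where S: "C < S" "S < T" using C(2) dense by blast
  have pos: "0 < S" "0 < T" using C S by auto
  have [measurable]: "poly q \<in> borel_measurable borel" for q :: "real poly"
    by (intro borel_measurable_continuous_onI continuous_intros)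
  define A where "A j = {x \<in> space M. (poly (Q j) x)\<^sup>2 \<ge> (T ^ m j)\<^sup>2}" for j
  have [measurable]: "A j \<in> sets M" for j unfolding A_def by measurable
  define q where "q = (S / T)\<^sup>2"
  have q: "0 \<le> q" "q < 1" unfolding q_def using S pos by (simp_all add: power_less_one_iff)
  have "eventually (\<lambda>j. L2_norm_poly M (Q j) powr (1 / real (m j)) < S) sequentially"
    using lim S(1) by (rule order_tendstoD)
  then have "eventually (\<lambda>j. norm (measure M (A j)) \<le> q ^ j) sequentially"
  proof eventually_elim
    fix j assume j: "L2_norm_poly M (Q j) powr (1 / real (m j)) < S"
    define L where "L = L2_norm_poly M (Q j)"
    have L0: "L \<ge> 0" by (simp add: L_def L2_norm_poly_def)
    have "L = (L powr (1 / real (m j))) ^ m j"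
      using L0 m(2)[of j] by (cases "L = 0") (auto simp: powr_power)
    also have "\<dots> \<le> S ^ m j" using j by (intro power_mono) (auto simp: L_def)
    finally have LS: "L\<^sup>2 \<le> (S ^ m j)\<^sup>2" using L0 by (intro power_mono)
    have int: "integrable M (\<lambda>x. (poly (Q j) x)\<^sup>2)"
      using integrable_poly[OF M r, of "(Q j)\<^sup>2"] by (simp add: poly_power[abs_def])
    have "measure M (A j) \<le> (\<integral>x. (poly (Q j) x)\<^sup>2 \<partial>M) / (T ^ m j)\<^sup>2"
      unfolding A_def using pos by (intro integral_Markov_inequality_measure[OF int, of "{}"]) auto
    also have "(\<integral>x. (poly (Q j) x)\<^sup>2 \<partial>M) = L\<^sup>2"
      by (simp add: L_def L2_norm_poly_def)
    also have "L\<^sup>2 / (T ^ m j)\<^sup>2 \<le> (S ^ m j)\<^sup>2 / (T ^ m j)\<^sup>2"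
      using LS by (rule divide_right_mono) simp
    also have "\<dots> = q ^ m j" by (simp add: q_def power_divide power_mult[symmetric] mult.commute)
    also have "\<dots> \<le> q ^ j" using q m(1)[of j] by (intro power_decreasing) auto
    finally show "norm (measure M (A j)) \<le> q ^ j" by simp
  qed
  then have "summable (\<lambda>j. measure M (A j))"
    using q by (intro summable_comparison_test_ev[OF _ summable_geometric]) auto
  then have "AE x in M. eventually (\<lambda>j. x \<in> space M - A j) sequentially"
    by (intro borel_cantelli_AE1) (auto simp: emeasure_finite less_top[symmetric])
  then show ?thesis
  proof eventually_elim
    fix x assume "eventually (\<lambda>j. x \<in> space M - A j) sequentially"
    then show "eventually (\<lambda>j. \<bar>poly (Q j) x\<bar> \<le> T ^ m j) sequentially"
    proof eventually_elim
      fix j assume "x \<in> space M - A j"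
      then have "(poly (Q j) x)\<^sup>2 \<le> (T ^ m j)\<^sup>2" by (auto simp: A_def)
      then show "\<bar>poly (Q j) x\<bar> \<le> T ^ m j" using pos by (simp add: abs_le_square_iff[symmetric])
    qed
  qed
qed

text \<open>The test function \<open>u\<close> is continuous, bounded and zero exactly on the
  interval; its integrals, all 0, pass to the limit.\<close>

lemma AE_weak_limit_interval:
  assumes "\<And>n. real_distribution (\<nu>s n)" "real_distribution \<nu>" "weak_conv_m \<nu>s \<nu>"
    and D: "\<And>n. AE x in \<nu>s n. x \<in> {-r..r}"
  shows "AE x in \<nu>. x \<in> {-r..r}"
proof -
  interpret real_distribution \<nu> by fact
  define u where "u x = ennreal (min 1 (max 0 (\<bar>x\<bar> - r)))" for x
  have cont: "continuous_on UNIV u" unfolding u_def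
    by (intro continuous_on_ennreal continuous_intros)
  then have [measurable]: "u \<in> borel_measurable borel" by (rule borel_measurable_continuous_onI)
  have "u x \<le> of_nat 1" for x
    unfolding u_def by (simp add: ennreal_le_1)
  then have "(\<lambda>n. \<integral>\<^sup>+x. u x \<partial>\<nu>s n) \<longlonglongrightarrow> (\<integral>\<^sup>+x. u x \<partial>\<nu>)"
    by (rule tendsto_nn_integral_weak_conv[OF assms(1-3) cont])
  moreover have "(\<integral>\<^sup>+x. u x \<partial>\<nu>s n) = 0" for n
  proof -
    have "(\<integral>\<^sup>+x. u x \<partial>\<nu>s n) = (\<integral>\<^sup>+x. 0 \<partial>\<nu>s n)"
      by (rule nn_integral_cong_AE, use D[of n] in eventually_elim) (auto simp: u_def)
    then show ?thesis by simp
  qed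
  ultimately have "(\<integral>\<^sup>+x. u x \<partial>\<nu>) = 0" by (simp add: LIMSEQ_const_iff)
  then have "AE x in \<nu>. u x = 0" by (subst (asm) nn_integral_0_iff_AE) auto
  then show ?thesis by eventually_elim (auto simp: u_def min_def max_def split: if_splits)
qed

text \<open>On \<open>E\<close> the logarithmic energy and the kernel energy differ by the constant
  \<open>ln R\<close>, so \<rho> minimises both. Positive capacity makes the minimum finite, since
  \<open>capacity\<close> is 0 by definition when the infimum is \<open>\<infinity>\<close>.\<close>

lemma equilibrium_potential:
  assumes R: "R \<ge> 1" and E: "E \<subseteq> {-R/2..R/2}" "compact E"
    and C: "capacity E > 0" and eq: "is_equilibrium_measure E \<rho>"
  obtains V where "V \<ge> 0" "capacity E = R * exp (- V)" "(\<integral>\<^sup>+x. potential R \<rho> x \<partial>\<rho>) = ennreal V"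
    "AE x in \<rho>. potential R \<rho> x \<le> ennreal V"
proof -
  define J where "J \<sigma> = (\<integral>\<^sup>+x. potential R \<sigma> x \<partial>\<sigma>)" for \<sigma>
  have mE: "E \<in> sets borel" using E(2) by (simp add: compact_imp_closed)
  have rho: "\<rho> \<in> prob_measures_on E" and I: "log_energy \<rho> = Inf (log_energy ` prob_measures_on E)"
    using eq by (auto simp: is_equilibrium_measure_def)
  have le: "log_energy \<sigma> = enn2ereal (J \<sigma>) - ereal (ln R)" if "\<sigma> \<in> prob_measures_on E" for \<sigma>
    unfolding J_def by (rule log_energy_eq[OF R E(1) that mE])
  have "J \<rho> \<noteq> \<infinity>"
  proof
    assume "J \<rho> = \<infinity>"
    then have "Inf (log_energy ` prob_measures_on E) = \<infinity>"
      unfolding I[symmetric] le[OF rho] by simp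
    then show False using C by (simp add: capacity_def)
  qed
  then obtain V where V: "J \<rho> = ennreal V" "V \<ge> 0" by (cases "J \<rho>") auto
  have eV: "Inf (log_energy ` prob_measures_on E) = ereal (V - ln R)"
    unfolding I[symmetric] le[OF rho] V(1) using V(2) by (simp add: enn2ereal_ennreal)
  have "capacity E = exp (ln R - V)" by (simp add: capacity_def Let_def eV)
  then have cap: "capacity E = R * exp (- V)" using R by (simp add: exp_diff exp_minus divide_inverse)
  have "ennreal V \<le> J \<sigma>" if "\<sigma> \<in> prob_measures_on E" for \<sigma>
  proof -
    have "ereal (V - ln R) \<le> log_energy \<sigma>"
      unfolding eV[symmetric] using that by (intro Inf_lower) auto
    then have "ereal V \<le> enn2ereal (J \<sigma>)" unfolding le[OF that] by (cases "enn2ereal (J \<sigma>)") auto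
    then show ?thesis using V(2) by (simp add: less_eq_ennreal.rep_eq enn2ereal_ennreal)
  qed
  then have "AE x in \<rho>. potential R \<rho> x \<le> ennreal V"
    using R V rho by (intro AE_potential_le_of_minimal[OF _ rho mE]) (auto simp: J_def)
  then show thesis using that V cap by (auto simp: J_def)
qed

lemma weak_limit_eq_equilibrium:
  assumes R: "R > 0" and rho: "prob_space \<rho>" "sets \<rho> = sets borel"
    and E: "compact E" "E \<subseteq> {-R/2..R/2}" "AE x in \<rho>. x \<in> E"
    and V: "V \<ge> 0" "(\<integral>\<^sup>+x. potential R \<rho> x \<partial>\<rho>) = ennreal V" "AE x in \<rho>. potential R \<rho> x \<le> ennreal V"
    and nus: "\<And>n. real_distribution (\<nu>s n)" "\<And>n. AE x in \<nu>s n. x \<in> {-R/2..R/2}"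
    and nu: "real_distribution \<nu>" "weak_conv_m \<nu>s \<nu>"
    and liminf: "AE x in \<rho>. ennreal V \<le> liminf (\<lambda>n. potential R (\<nu>s n) x)"
  shows "\<nu> = \<rho>"
proof -
  interpret prob_space \<rho> by fact
  interpret nu: real_distribution \<nu> by fact
  have sf: "sigma_finite_measure \<rho>" "sigma_finite_measure \<nu>"
    by (rule sigma_finite_measure_axioms nu.sigma_finite_measure_axioms)+
  note [measurable_cong] = rho(2)
  note [measurable] = measurable_potential[OF sf(1) rho(2)] measurable_potential[OF sf(2) nu.events_eq_borel]
  have Dnu: "AE x in \<nu>. x \<in> {-R/2..R/2}"
    using AE_weak_limit_interval[OF nus(1) nu, of "R/2"] nus(2) by simp
  have closed: "closed {x. potential R \<rho> x \<le> ennreal V}" "closed {x. potential R \<nu> x \<le> ennreal V}"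
    by (rule closed_potential_le[OF R finite_measure_axioms rho(2)]
        closed_potential_le[OF R nu.finite_measure_axioms nu.events_eq_borel])+
  have V_fin: "ennreal V < \<infinity>" by simp
  have off: "potential R \<rho> x < ennreal V"
    if "closed S" "S \<subseteq> E" "AE y in \<rho>. y \<in> S" "\<And>y. y \<in> S \<Longrightarrow> potential R \<rho> y \<le> ennreal V"
      "x \<in> {-R/2..R/2}" "x \<notin> S" for S x
    by (rule potential_less_off_carrier[OF R rho that(1) order_trans[OF that(2) E(2)] that(3,4) V_fin that(5,6)])
  \<comment> \<open>The bound is known only \<rho>-almost everywhere. The points of \<open>E\<close>
    where it holds form a closed carrier of \<rho>, so the maximum principle extends it to the whole
    interval.\<close>
  have rho_le: "potential R \<rho> x \<le> ennreal V" if "x \<in> {-R/2..R/2}" for x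
  proof (cases "x \<in> E \<inter> {x. potential R \<rho> x \<le> ennreal V}")
    case False
    have "potential R \<rho> x < ennreal V"
    proof (rule off[OF _ _ _ _ that False])
      show "closed (E \<inter> {x. potential R \<rho> x \<le> ennreal V})"
        by (intro closed_Int closed compact_imp_closed[OF E(1)])
      show "AE y in \<rho>. y \<in> E \<inter> {x. potential R \<rho> x \<le> ennreal V}"
        using E(3) V(3) by eventually_elim simp
      show "E \<inter> {x. potential R \<rho> x \<le> ennreal V} \<subseteq> E" by (rule Int_lower1)
      show "potential R \<rho> y \<le> ennreal V" if "y \<in> E \<inter> {x. potential R \<rho> x \<le> ennreal V}" for y
        using that by (simp only: Int_iff mem_Collect_eq)
    qed
    then show ?thesis by (rule less_imp_le)
  qed (simp only: Int_iff mem_Collect_eq)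
  have ge: "AE x in \<rho>. ennreal V \<le> potential R \<nu> x"
    by (rule AE_le_potential_of_liminf[OF R rho _ _ nus(1) nu liminf]) (simp_all add: V)
  have comm: "(\<integral>\<^sup>+x. potential R \<rho> x \<partial>\<nu>) = (\<integral>\<^sup>+x. potential R \<nu> x \<partial>\<rho>)"
    by (rule potential_commute[OF sf(1) rho(2) sf(2) nu.events_eq_borel])
  have V_nu: "(\<integral>\<^sup>+x. ennreal V \<partial>\<nu>) = ennreal V" and V_rho: "(\<integral>\<^sup>+x. ennreal V \<partial>\<rho>) = ennreal V"
    using nu.emeasure_space_1 emeasure_space_1 by simp_all
  have le_V: "(\<integral>\<^sup>+x. potential R \<rho> x \<partial>\<nu>) \<le> ennreal V"
  proof -
    have "(\<integral>\<^sup>+x. potential R \<rho> x \<partial>\<nu>) \<le> (\<integral>\<^sup>+x. ennreal V \<partial>\<nu>)"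
      by (rule nn_integral_mono_AE, use Dnu in eventually_elim) (rule rho_le)
    then show ?thesis by (simp only: V_nu)
  qed
  have ge_V: "ennreal V \<le> (\<integral>\<^sup>+x. potential R \<rho> x \<partial>\<nu>)"
    using nn_integral_mono_AE[OF ge] by (simp only: comm V_rho)
  \<comment> \<open>The mean of \<open>potential R \<nu>\<close> under \<rho> is at most
    \<open>V\<close> while the function is at least \<open>V\<close> almost everywhere, so it cannot
    exceed \<open>V\<close> on a set of positive mass.\<close>
  have nu_le: "AE x in \<rho>. potential R \<nu> x \<le> ennreal V"
  proof (rule ccontr)
    assume "\<not> ?thesis"
    then have "(\<integral>\<^sup>+x. ennreal V \<partial>\<rho>) < (\<integral>\<^sup>+x. potential R \<nu> x \<partial>\<rho>)"
    proof (rule nn_integral_less[rotated 4])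
      show "(\<integral>\<^sup>+x. ennreal V \<partial>\<rho>) \<noteq> \<infinity>" unfolding V_rho by simp
      show "AE x in \<rho>. ennreal V \<le> potential R \<nu> x" by (rule ge)
    qed measurable
    then show False using le_V unfolding comm V_rho by (simp only: not_less)
  qed
  define S where "S = E \<inter> {x. potential R \<rho> x \<le> ennreal V} \<inter> {x. potential R \<nu> x \<le> ennreal V}"
  have S: "closed S" "S \<subseteq> E" "AE x in \<rho>. x \<in> S"
  proof -
    show "closed S" unfolding S_def by (intro closed_Int closed compact_imp_closed[OF E(1)])
    show "AE x in \<rho>. x \<in> S" using E(3) V(3) nu_le by eventually_elim (simp add: S_def)
  qed (auto simp: S_def)
  have S_le: "potential R \<rho> y \<le> ennreal V" if "y \<in> S" for y using that by (simp add: S_def)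
  \<comment> \<open>Off \<open>S\<close> the maximum principle gives
    \<open>potential R \<rho> x < V\<close>. If \<nu> charged the complement of \<open>S\<close>,
    the mean under \<nu> would drop below \<open>V\<close>, against \<open>ge_V\<close>.\<close>
  have AE_S: "AE x in \<nu>. x \<in> S"
  proof (rule ccontr)
    assume not: "\<not> ?thesis"
    have "(\<integral>\<^sup>+x. potential R \<rho> x \<partial>\<nu>) < (\<integral>\<^sup>+x. ennreal V \<partial>\<nu>)"
    proof (rule nn_integral_less)
      show "AE x in \<nu>. potential R \<rho> x \<le> ennreal V" using Dnu by eventually_elim (rule rho_le)
      show "\<not> (AE x in \<nu>. ennreal V \<le> potential R \<rho> x)"
      proof
        assume "AE x in \<nu>. ennreal V \<le> potential R \<rho> x"
        then have "AE x in \<nu>. x \<in> S"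
          using Dnu
        proof eventually_elim
          fix x assume "ennreal V \<le> potential R \<rho> x" "x \<in> {-R/2..R/2}"
          then show "x \<in> S" using off[OF S S_le, of x] by (meson not_less)
        qed
        then show False using not by simp
      qed
      show "(\<integral>\<^sup>+x. potential R \<rho> x \<partial>\<nu>) \<noteq> \<infinity>" using le_V by (auto simp: top_unique)
    qed measurable
    then show False using ge_V unfolding V_nu by (simp only: not_less)
  qed
  have "(\<integral>\<^sup>+x. potential R \<nu> x \<partial>\<nu>) \<le> (\<integral>\<^sup>+x. ennreal V \<partial>\<nu>)"
    by (rule nn_integral_mono_AE, use AE_S in eventually_elim) (simp add: S_def)
  then have "(\<integral>\<^sup>+x. potential R \<nu> x \<partial>\<nu>) \<le> ennreal V" by (simp only: V_nu)
  moreover have "AE x in \<rho>. x \<in> {-R/2..R/2}" using E(3) by eventually_elim (rule subsetD[OF E(2)])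
  moreover have "(\<integral>\<^sup>+x. potential R \<rho> x \<partial>\<rho>) \<le> ennreal V" by (simp only: V(2) order_refl)
  ultimately show ?thesis
    using ge_V by (intro equal_of_energy_le[OF R nu.prob_space_axioms nu.events_eq_borel rho Dnu])
qed

theorem theorem4p2:
  fixes \<mu> \<rho> :: "real measure" and E :: "real set"
    and P :: "nat \<Rightarrow> real poly" and n :: "nat \<Rightarrow> nat"
  assumes "finite_measure \<mu>" and "sets \<mu> = sets borel" and "compact (msupp \<mu>)"
    and "compact E" and "E \<subseteq> msupp \<mu>" and "essentially_perfect E" and "capacity E > 0"
    and "is_equilibrium_measure E \<rho>" and "absolutely_continuous \<mu> \<rho>"
    and "\<And>k. is_monic_OP \<mu> k (P k)"
    and "strict_mono n"
    and "(\<lambda>j. L2_norm_poly \<mu> (P (n j)) powr (1 / real (n j))) \<longlonglongrightarrow> capacity E"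
  shows "weakly_converges (\<lambda>j. zero_counting_measure (P (n j))) (distr \<rho> borel complex_of_real)"
proof -

  \<comment> \<open>Enclosing interval and equilibrium potential\<close>
  obtain B where B: "\<And>x. x \<in> msupp \<mu> \<Longrightarrow> \<bar>x\<bar> \<le> B"
    using compact_imp_bounded[OF assms(3)] unfolding bounded_iff by auto
  \<comment> \<open>The factor 2 puts the support in the interval of length \<open>R\<close> centred
    at 0, where the kernel is not truncated; the maximum with 1 keeps \<open>ln R\<close>
    nonnegative.\<close>
  define R where "R = max 1 (2 * B)"
  have R: "R \<ge> 1" "R > 0" by (auto simp: R_def)
  let ?D = "{-R/2..R/2}"
  have supp_D: "msupp \<mu> \<subseteq> ?D"
  proof
    fix x assume "x \<in> msupp \<mu>"
    then have "\<bar>x\<bar> \<le> R / 2" using B by (fastforce simp: R_def)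
    then show "x \<in> ?D" by auto
  qed
  then have E_D: "E \<subseteq> ?D" using assms(5) by simp
  have mu_D: "AE x in \<mu>. x \<in> {-(R/2)..R/2}"
    using AE_msupp[OF assms(2)] by eventually_elim (use supp_D in auto)
  have rho: "prob_space \<rho>" "sets \<rho> = sets borel" "emeasure \<rho> E = 1"
    using assms(8) by (auto simp: is_equilibrium_measure_def prob_measures_on_def)
  interpret rho: prob_space \<rho> by fact
  interpret rho: real_distribution \<rho> by unfold_locales (rule rho(2))
  have rho_E: "AE x in \<rho>. x \<in> E"
    using rho(3) assms(4) by (subst rho.AE_in_set_eq_1) (auto simp: measure_def compact_imp_closed)
  have "E \<noteq> {}" using rho(3) by auto
  have inf: "q = 0" if "AE x in \<mu>. poly q x = 0" for q :: "real poly"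
    by (rule poly_eq_0_of_AE_essentially_perfect[OF assms(2,5,6) \<open>E \<noteq> {}\<close> that])
  obtain V where V: "V \<ge> 0" "capacity E = R * exp (- V)" "(\<integral>\<^sup>+x. potential R \<rho> x \<partial>\<rho>) = ennreal V"
    "AE x in \<rho>. potential R \<rho> x \<le> ennreal V"
    using equilibrium_potential[OF R(1) E_D assms(4,7,8)] by blast

  \<comment> \<open>Zero counting measures on the real line\<close>
  define m where "m j = n (Suc j)" for j
  \<comment> \<open>The index is shifted by one because \<open>n 0\<close> may be 0, and a constant
    polynomial has no zeros to count.\<close>
  have m: "j \<le> m j" "0 < m j" for j
    using seq_suble[OF assms(11), of "Suc j"] by (simp_all add: m_def)
  have deg: "degree (P k) = k" "lead_coeff (P k) = 1" for k
    using assms(10)[of k] unfolding is_monic_OP_def by blast+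
  have degm: "degree (P (m j)) > 0" for j using m by (simp add: deg)
  have zeros: "Im z = 0" "Re z \<in> ?D" if "poly (map_poly complex_of_real (P (m j))) z = 0" for j z
    using monic_OP_zeros_real[OF assms(1,2) mu_D inf assms(10) that] by simp_all
  let ?Z = "\<lambda>j. zero_counting_measure (P (m j))"
  \<comment> \<open>All zeros are real, so projecting by \<open>Re\<close> loses nothing and gives
    distributions on the real line.\<close>
  define \<nu>s where "\<nu>s j = distr (?Z j) borel Re" for j
  interpret Z: prob_space "?Z j" for j by (rule prob_space_zero_counting_measure[OF degm])
  have nus: "real_distribution (\<nu>s j)" for j
    unfolding \<nu>s_def by (intro real_distribution.intro real_distribution_axioms.intro Z.prob_space_distr) auto
  have nus_D: "AE x in \<nu>s j. x \<in> ?D" for j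
  proof -
    have "AE z in ?Z j. Re z \<in> ?D"
      by (rule AE_zero_counting_measure[OF degm zeros(2)]) measurable
    then show ?thesis unfolding \<nu>s_def by (subst AE_distr_iff) auto
  qed

  \<comment> \<open>Lower bound for the potentials almost everywhere\<close>
  have lim: "(\<lambda>j. L2_norm_poly \<mu> (P (m j)) powr (1 / real (m j))) \<longlonglongrightarrow> capacity E"
    unfolding m_def using LIMSEQ_Suc[OF assms(12)] .
  \<comment> \<open>Countably many thresholds decreasing to \<open>capacity E\<close> leave one
    common null set of \<mu>, which absolute continuity makes null for \<rho>.\<close>
  have "AE x in \<mu>. \<forall>k. eventually (\<lambda>j. \<bar>poly (P (m j)) x\<bar> \<le> (capacity E * exp (1 / real (Suc k))) ^ m j) sequentially"
    unfolding AE_all_countable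
    by (intro allI AE_eventually_poly_le[OF assms(1,2) mu_D m lim assms(7)]) (use assms(7) in simp)
  then have "AE x in \<rho>. \<forall>k. eventually (\<lambda>j. \<bar>poly (P (m j)) x\<bar> \<le> (capacity E * exp (1 / real (Suc k))) ^ m j) sequentially"
    using absolutely_continuous_AE[OF _ assms(9)] rho(2) assms(2) by simp
  then have liminf: "AE x in \<rho>. ennreal V \<le> liminf (\<lambda>j. potential R (\<nu>s j) x)"
    using rho_E
  proof eventually_elim
    fix x assume ev: "\<forall>k. eventually (\<lambda>j. \<bar>poly (P (m j)) x\<bar> \<le> (capacity E * exp (1 / real (Suc k))) ^ m j) sequentially"
      and "x \<in> E"
    then have x: "x \<in> ?D" using E_D by blast
    have "ennreal (V - 1 / real (Suc k)) \<le> liminf (\<lambda>j. potential R (\<nu>s j) x)" for k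
    proof (rule Liminf_bounded)
      let ?T = "capacity E * exp (1 / real (Suc k))"
      have T: "?T > 0" using assms(7) by simp
      have "?T = R * exp (- (V - 1 / real (Suc k)))"
        by (simp add: V(2) mult.assoc exp_add[symmetric])
      then have lnT: "ln (R / ?T) = V - 1 / real (Suc k)"
        using R(2) by (simp only: ln_div ln_mult ln_exp) (simp add: ln_div ln_mult)
      show "eventually (\<lambda>j. ennreal (V - 1 / real (Suc k)) \<le> potential R (\<nu>s j) x) sequentially"
        using ev[rule_format, of k]
      proof eventually_elim
        fix j assume le: "\<bar>poly (P (m j)) x\<bar> \<le> ?T ^ m j"
        have "Im z = 0 \<and> \<bar>x - Re z\<bar> \<le> R" if "poly (map_poly complex_of_real (P (m j))) z = 0" for z
          using zeros(1)[OF that] zeros(2)[OF that] x by auto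
        then have "ennreal (ln (R / ?T)) \<le> potential R (\<nu>s j) x"
          unfolding \<nu>s_def using le
          by (intro potential_zero_counting_measure_ge R(2) T degm deg) (auto simp: deg)
        then show "ennreal (V - 1 / real (Suc k)) \<le> potential R (\<nu>s j) x" by (simp only: lnT)
      qed
    qed
    moreover have "(\<lambda>k. ennreal (V - 1 / real (Suc k))) \<longlonglongrightarrow> ennreal (V - 0)"
      using LIMSEQ_inverse_real_of_nat
      by (intro tendsto_ennrealI tendsto_diff tendsto_const) (simp add: inverse_eq_divide)
    ultimately have "ennreal (V - 0) \<le> liminf (\<lambda>j. potential R (\<nu>s j) x)"
      by (intro LIMSEQ_le_const2) auto
    then show "ennreal V \<le> liminf (\<lambda>j. potential R (\<nu>s j) x)" by simp
  qed

  \<comment> \<open>Tightness and subsequential limits\<close>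
  have "tight \<nu>s"
    unfolding tight_def
  proof (intro conjI allI impI nus)
    fix \<epsilon> :: real assume "\<epsilon> > 0"
    have "measure (\<nu>s j) {-R<..R} = 1" for j
    proof -
      interpret real_distribution "\<nu>s j" by (rule nus)
      have "AE x in \<nu>s j. x \<in> {-R<..R}" using nus_D[of j] by eventually_elim (use R in auto)
      then show ?thesis by (subst (asm) AE_in_set_eq_1) auto
    qed
    then show "\<exists>a b. a < b \<and> (\<forall>j. measure (\<nu>s j) {a<..b} > 1 - \<epsilon>)"
      using R \<open>\<epsilon> > 0\<close> by (intro exI[of _ "-R"] exI[of _ R]) auto
  qed
  \<comment> \<open>For a tight sequence it suffices that every weakly convergent subsequence has
    limit \<rho>. The lower bound survives, because passing to a subsequence can only raise the
    \<open>liminf\<close>.\<close>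
  then have conv: "weak_conv_m \<nu>s \<rho>"
  proof (rule tight_subseq_weak_converge[OF nus rho.real_distribution_axioms])
    fix s \<nu> assume s: "strict_mono (s :: nat \<Rightarrow> nat)" and nu: "real_distribution \<nu>" "weak_conv_m (\<nu>s \<circ> s) \<nu>"
    have "AE x in \<rho>. ennreal V \<le> liminf (\<lambda>j. potential R ((\<nu>s \<circ> s) j) x)"
      using liminf
    proof eventually_elim
      fix x assume "ennreal V \<le> liminf (\<lambda>j. potential R (\<nu>s j) x)"
      also have "\<dots> \<le> liminf ((\<lambda>j. potential R (\<nu>s j) x) \<circ> s)" by (rule liminf_subseq_mono[OF s])
      finally show "ennreal V \<le> liminf (\<lambda>j. potential R ((\<nu>s \<circ> s) j) x)" by (simp add: o_def)
    qed
    have "\<nu> = \<rho>"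
    proof (rule weak_limit_eq_equilibrium[OF R(2) rho(1,2) assms(4) E_D rho_E V(1,3,4) _ _ nu])
      show "real_distribution ((\<nu>s \<circ> s) k)" for k using nus[of "s k"] by (simp only: o_apply)
      show "AE x in (\<nu>s \<circ> s) k. x \<in> ?D" for k using nus_D[of "s k"] by (simp only: o_apply)
    qed fact
    then show "weak_conv_m (\<nu>s \<circ> s) \<rho>" using nu(2) by simp
  qed

  \<comment> \<open>Return to measures on the complex plane\<close>
  show ?thesis
    unfolding weakly_converges_def
  proof (intro allI impI)
    fix f :: "complex \<Rightarrow> real"
    assume f: "continuous_on UNIV f \<and> bounded (range f)"
    then obtain K where K: "\<And>x. norm (f x) \<le> K" by (auto simp: bounded_iff)
    have [measurable]: "f \<in> borel_measurable borel" using f by (intro borel_measurable_continuous_onI) simp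
    have cont: "continuous_on UNIV (\<lambda>x. f (complex_of_real x))"
      by (rule continuous_on_compose2[OF conjunct1[OF f] continuous_on_of_real[OF continuous_on_id]]) simp
    have "(\<lambda>j. \<integral>x. f (complex_of_real x) \<partial>\<nu>s j) \<longlonglongrightarrow> (\<integral>x. f (complex_of_real x) \<partial>\<rho>)"
      by (rule weak_conv_imp_integral_bdd_continuous_conv[OF nus rho.real_distribution_axioms conv, where B=K])
        (use cont K in \<open>auto simp: continuous_on_eq_continuous_at\<close>)
    moreover have "(\<integral>x. f (complex_of_real x) \<partial>\<nu>s j) = (\<integral>z. f z \<partial>?Z j)" for j
    proof -
      have "AE z in ?Z j. complex_of_real (Re z) = z"
      proof (rule AE_zero_counting_measure[OF degm])
        show "complex_of_real (Re z) = z" if "poly (map_poly complex_of_real (P (m j))) z = 0" for z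
          using zeros(1)[OF that] by (simp only: complex_eq_iff Re_complex_of_real Im_complex_of_real simp_thms)
      qed measurable
      then have "(\<integral>z. f (complex_of_real (Re z)) \<partial>?Z j) = (\<integral>z. f z \<partial>?Z j)"
        by (intro integral_cong_AE, measurable, eventually_elim) simp
      moreover have "(\<integral>x. f (complex_of_real x) \<partial>\<nu>s j) = (\<integral>z. f (complex_of_real (Re z)) \<partial>?Z j)"
        unfolding \<nu>s_def by (rule integral_distr) measurable
      ultimately show ?thesis by (simp only:)
    qed
    moreover have "(\<integral>x. f (complex_of_real x) \<partial>\<rho>) = (\<integral>z. f z \<partial>distr \<rho> borel complex_of_real)"
      by (rule integral_distr[symmetric]) measurable
    ultimately have "(\<lambda>j. \<integral>z. f z \<partial>zero_counting_measure (P (n (Suc j)))) \<longlonglongrightarrow>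
        (\<integral>z. f z \<partial>distr \<rho> borel complex_of_real)"
      by (simp add: m_def)
    then show "(\<lambda>j. \<integral>z. f z \<partial>zero_counting_measure (P (n j))) \<longlonglongrightarrow>
        (\<integral>z. f z \<partial>distr \<rho> borel complex_of_real)"
      by (rule LIMSEQ_imp_Suc)
  qed
qed

end
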